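(* Assume A1, A2 and A3 (stated in the context). Then: (i) $r_k^{\mathrm{primal}}=r_k^{\mathrm{dual}}\le r^{\star}$, and the infimum $r_k^{\mathrm{dual}}$ is attained, for each $k\in\mathbb{N}$; (ii) $\lim_{k\to\infty} r_k^{\mathrm{primal}}=\lim_{k\to\infty} r_k^{\mathrm{dual}}=r^{\star}$; (iii) for each $k$ let $\mathscr{L}_k^{\star}$ be a minimizer of $(\mathrm{D}_k)$. For any convergent subsequence $\{\mathscr{L}^{\star}_{k_i}(x)/\mathscr{L}^{\star}_{k_i}(1)\}_i$ of $\{\mathscr{L}^{\star}_k(x)/\mathscr{L}^{\star}_k(1)\}_k$ (such a convergent subsequence always exists), one has $\lim_{i\to\infty}\mathscr{L}^{\star}_{k_i}(x)/\mathscr{L}^{\star}_{k_i}(1)\in\mathbf{S}$. Consequently, if $\mathbf{S}$ is a singleton, then $\lim_{k\to\infty}\mathscr{L}^{\star}_k(x)/\mathscr{L}^{\star}_k(1)$ exists and is the unique minimizer of (FSIPP).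
   Context: Problem. Let $x=(x_1,\dots,x_m)$, $y=(y_1,\dots,y_n)$, $f,g,\varphi_1,\dots,\varphi_s\in\mathbb{R}[x]$, $p\in\mathbb{R}[x,y]$, $\mathbf{Y}\subset\mathbb{R}^n$. The problem (FSIPP) is $$r^{\star}:=\min_{x\in\mathbb{R}^m} \frac{f(x)}{g(x)}\quad\text{s.t. } \varphi_1(x)\le 0,\dots,\varphi_s(x)\le 0,\quad p(x,y)\le 0\ \ \forall y\in\mathbf{Y}.$$ $\mathbf{K}$ is its feasible set and $\mathbf{S}$ its set of optimal solutions; it is assumed throughout that $\mathbf{S}\ne\emptyset$. A polynomial $h\in\mathbb{R}[x]$ is sos-convex if there are an integer $r$ and a matrix polynomial $H\in\mathbb{R}[x]^{r\times m}$ with $\nabla^2h=H(x)^TH(x)$. Assumptions. A1: (i) $\mathbf{Y}\subseteq[-1,1]^n$ and $\mathbf{Y}$ is closed; (ii) $\varphi_1,\dots,\varphi_s$ and $p(\cdot,y)$ for every $y\in\mathbf{Y}$ are sos-convex. A2: (i) $f$ and $-g$ are sos-convex; (ii) either $f(x)\ge0$ and $g(x)>0$ for all $x\in\mathbf{K}$, or $g$ is affine and $g(x)>0$ for all $x\in\mathbf{K}$. A3 (Slater): there is $u\in\mathbf{K}$ with $p(u,y)<0$ for all $y\in\mathbf{Y}$ and $\varphi_j(u)<0$ for $j=1,\dots,s$. Notation. $\mathbb{N}$ is the set of nonnegative integers. $\mathbb{R}[x]_k$, $\mathbb{R}[y]_k$: polynomials of degree at most $k$; $A^*$ is the space of linear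 functionals on a vector space $A$. $\Sigma^2[x]$ (resp. $\Sigma^2[y]$) is the set of sums of squares of polynomials, $\Sigma^2_k[y]=\Sigma^2[y]\cap\mathbb{R}[y]_{2k}$. $d_y:=\deg_y p(x,y)$, and $\mathbf{d}:=\lceil\max\{\deg f,\deg g,\deg\varphi_1,\dots,\deg\varphi_s,\deg_x p(x,y)\}/2\rceil$ (with $\mathbf{d}\ge1$). For $\mathscr{L}\in(\mathbb{R}[x]_{2\mathbf{d}})^*$, $\mathscr{L}(x):=(\mathscr{L}(x_1),\dots,\mathscr{L}(x_m))\in\mathbb{R}^m$, and $\mathscr{L}(p(x,y))\in\mathbb{R}[y]$ is obtained by applying $\mathscr{L}$ to $p$ viewed as a polynomial in $x$ with coefficients in $\mathbb{R}[y]$; similarly $\mathscr{H}(p(x,y))\in\mathbb{R}[x]$ for a linear functional $\mathscr{H}$ on $\mathbb{R}[y]_{d_y}$. For a convex cone $C$ in a finite-dimensional polynomial space, $C^*$ denotes the dual cone of linear functionals that are nonnegative on $C$. $\nu$ is a fixed finite Borel measure with support exactly $\mathbf{Y}$, and for $k\in\mathbb{N}$ $$\mathcal{P}^k(\mathbf{Y}):=\Big\{\psi\in\mathbb{R}[y]_{d_y}\ \Big|\ \int_{\mathbf{Y}}\psi\,\sigma\,d\nu\ge0\ \ \forall\sigma\in\Sigma^2_k[y]\Big\}.$$ Fixed constants $\mathfrak{R}>0$ and $g^{\star}>0$ are such that $\|u^{\star}\|\le\mathfrak{R}$ and $g(u^{\star})\ge g^{\star}$ for some $u^{\star}\in\mathbf{S}$.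 Put $q_0=1$, $q_1=\mathfrak{R}^2-\|x\|^2$, $q_2=g-g^{\star}$, $Q=\{q_1,q_2\}$, and $$\mathbf{M}_{\mathbf{d}}(Q):=\Big\{\sum_{j=0}^2\sigma_jq_j\ \Big|\ \sigma_j\in\Sigma^2[x],\ \deg(\sigma_jq_j)\le2\mathbf{d}\Big\}\subset\mathbb{R}[x]_{2\mathbf{d}}.$$ Relaxations. $r_k^{\mathrm{primal}}$ is the supremum of $\rho$ over $\rho\in\mathbb{R}$, $\mathscr{H}\in(\mathcal{P}^k(\mathbf{Y}))^*$, $\eta\in\mathbb{R}_+^s$ such that $f-\rho g+\mathscr{H}(p(x,y))+\sum_{j=1}^s\eta_j\varphi_j\in\mathbf{M}_{\mathbf{d}}(Q)$. The problem $(\mathrm{D}_k)$ is $$r_k^{\mathrm{dual}}:=\inf_{\mathscr{L}\in(\mathbb{R}[x]_{2\mathbf{d}})^*}\mathscr{L}(f)\quad\text{s.t. }\mathscr{L}\in(\mathbf{M}_{\mathbf{d}}(Q))^*,\ \mathscr{L}(g)=1,\ -\mathscr{L}(p(x,y))\in\mathcal{P}^k(\mathbf{Y}),\ \mathscr{L}(\varphi_j)\le0\ (j=1,\dots,s).$$ *)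

theory Defs
  imports "HOL-Analysis.Analysis" "HOL-Analysis.Finite_Function_Topology"
begin

text \<open>
  Exponents in the variables indexed by a finite type are finitely supported maps into the natural
  numbers; polynomials are the monoid algebra over the exponents. Bivariate polynomials are the
  monoid algebra over pairs (exponent of x, exponent of y), so ring operations and scalar
  multiplication are those of the library type of finitely supported functions.
\<close>

type_synonym 'v mpoly = "('v \<Rightarrow>\<^sub>0 nat) \<Rightarrow>\<^sub>0 real"
type_synonym ('v, 'w) mpoly2 = "(('v \<Rightarrow>\<^sub>0 nat) \<times> ('w \<Rightarrow>\<^sub>0 nat)) \<Rightarrow>\<^sub>0 real"

definition mon :: "('v \<Rightarrow>\<^sub>0 nat) \<Rightarrow> 'v mpoly" where
  "mon a = Poly_Mapping.single a 1"

definition var :: "'v \<Rightarrow> 'v mpoly" where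
  "var i = mon (Poly_Mapping.single i 1)"

definition const :: "real \<Rightarrow> 'v mpoly" where
  "const c = Poly_Mapping.single 0 c"

definition mon_eval :: "('v::finite \<Rightarrow>\<^sub>0 nat) \<Rightarrow> real^'v \<Rightarrow> real" where
  "mon_eval a x = (\<Prod>i\<in>UNIV. (x $ i) ^ Poly_Mapping.lookup a i)"

definition peval :: "'v::finite mpoly \<Rightarrow> real^'v \<Rightarrow> real" where
  "peval h x = (\<Sum>a\<in>Poly_Mapping.keys h. Poly_Mapping.lookup h a * mon_eval a x)"

definition mon_deg :: "('v::finite \<Rightarrow>\<^sub>0 nat) \<Rightarrow> nat" where
  "mon_deg a = (\<Sum>i\<in>UNIV. Poly_Mapping.lookup a i)"

text \<open>Total degrees; the zero polynomial has degree 0.\<close>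

definition pdeg :: "'v::finite mpoly \<Rightarrow> nat" where
  "pdeg h = Max (insert 0 (mon_deg ` Poly_Mapping.keys h))"

definition pdeg_x :: "('v::finite, 'w::finite) mpoly2 \<Rightarrow> nat" where
  "pdeg_x p = Max (insert 0 ((\<lambda>(a, b). mon_deg a) ` Poly_Mapping.keys p))"

definition pdeg_y :: "('v::finite, 'w::finite) mpoly2 \<Rightarrow> nat" where
  "pdeg_y p = Max (insert 0 ((\<lambda>(a, b). mon_deg b) ` Poly_Mapping.keys p))"

definition polys_le :: "nat \<Rightarrow> 'v::finite mpoly set" where
  "polys_le k = {h. pdeg h \<le> k}"

text \<open>For \<open>lookup a i = 0\<close> the truncated exponent is harmless because the coefficient vanishes.\<close>

definition partial :: "'v \<Rightarrow> 'v mpoly \<Rightarrow> 'v mpoly" where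
  "partial i h = (\<Sum>a\<in>Poly_Mapping.keys h.
     Poly_Mapping.single (a - Poly_Mapping.single i 1)
       (real (Poly_Mapping.lookup a i) * Poly_Mapping.lookup h a))"

definition sos_convex :: "'v mpoly \<Rightarrow> bool" where
  "sos_convex h \<longleftrightarrow> (\<exists>(r::nat) (H :: nat \<Rightarrow> 'v \<Rightarrow> 'v mpoly).
     \<forall>i j. partial i (partial j h) = (\<Sum>l<r. H l i * H l j))"

definition sos :: "'v mpoly set" where
  "sos = {h. \<exists>(r::nat) (q :: nat \<Rightarrow> 'v mpoly). h = (\<Sum>l<r. (q l)^2)}"

definition sub_y :: "('v, 'w::finite) mpoly2 \<Rightarrow> real^'w \<Rightarrow> 'v mpoly" where
  "sub_y p y = (\<Sum>(a, b)\<in>Poly_Mapping.keys p.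
     (Poly_Mapping.lookup p (a, b) * mon_eval b y) *\<^sub>R mon a)"

definition apply_x :: "('v mpoly \<Rightarrow> real) \<Rightarrow> ('v, 'w) mpoly2 \<Rightarrow> 'w mpoly" where
  "apply_x L p = (\<Sum>(a, b)\<in>Poly_Mapping.keys p.
     (Poly_Mapping.lookup p (a, b) * L (mon a)) *\<^sub>R mon b)"

definition apply_y :: "('w mpoly \<Rightarrow> real) \<Rightarrow> ('v, 'w) mpoly2 \<Rightarrow> 'v mpoly" where
  "apply_y H p = (\<Sum>(a, b)\<in>Poly_Mapping.keys p.
     (Poly_Mapping.lookup p (a, b) * H (mon b)) *\<^sub>R mon a)"

text \<open>
  Linear functionals on a linear subspace \<open>A\<close> of polynomials are represented by functions that are
  \<open>undefined\<close> outside \<open>A\<close>, so that they correspond bijectively to the elements of the dual space.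
\<close>

definition dual_space :: "'v mpoly set \<Rightarrow> ('v mpoly \<Rightarrow> real) set" where
  "dual_space A = {L \<in> extensional A.
     (\<forall>h\<in>A. \<forall>q\<in>A. L (h + q) = L h + L q) \<and> (\<forall>c. \<forall>h\<in>A. L (c *\<^sub>R h) = c * L h)}"

definition dual_cone :: "'v mpoly set \<Rightarrow> 'v mpoly set \<Rightarrow> ('v mpoly \<Rightarrow> real) set" where
  "dual_cone A C = {L \<in> dual_space A. \<forall>h\<in>C. 0 \<le> L h}"

definition feasible_set ::
  "nat \<Rightarrow> (nat \<Rightarrow> 'm::finite mpoly) \<Rightarrow> ('m, 'n::finite) mpoly2 \<Rightarrow> (real^'n) set \<Rightarrow> (real^'m) set" where
  "feasible_set s \<phi> p Y =
     {x. (\<forall>j\<in>{1..s}. peval (\<phi> j) x \<le> 0) \<and> (\<forall>y\<in>Y. peval (sub_y p y) x \<le> 0)}"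

definition optimal_set ::
  "'m::finite mpoly \<Rightarrow> 'm mpoly \<Rightarrow> nat \<Rightarrow> (nat \<Rightarrow> 'm mpoly) \<Rightarrow> ('m, 'n::finite) mpoly2 \<Rightarrow> (real^'n) set
    \<Rightarrow> (real^'m) set" where
  "optimal_set f g s \<phi> p Y = {x \<in> feasible_set s \<phi> p Y.
     \<forall>z\<in>feasible_set s \<phi> p Y. peval f x / peval g x \<le> peval f z / peval g z}"

definition r_star ::
  "'m::finite mpoly \<Rightarrow> 'm mpoly \<Rightarrow> nat \<Rightarrow> (nat \<Rightarrow> 'm mpoly) \<Rightarrow> ('m, 'n::finite) mpoly2 \<Rightarrow> (real^'n) set
    \<Rightarrow> ereal" where
  "r_star f g s \<phi> p Y = (INF x\<in>feasible_set s \<phi> p Y. ereal (peval f x / peval g x))"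

definition measure_support :: "'a::topological_space measure \<Rightarrow> 'a set" where
  "measure_support \<nu> = {y. \<forall>U. open U \<and> y \<in> U \<longrightarrow> emeasure \<nu> U > 0}"

definition half_deg ::
  "'m::finite mpoly \<Rightarrow> 'm mpoly \<Rightarrow> nat \<Rightarrow> (nat \<Rightarrow> 'm mpoly) \<Rightarrow> ('m, 'n::finite) mpoly2 \<Rightarrow> nat" where
  "half_deg f g s \<phi> p =
     nat \<lceil>real (Max ({pdeg f, pdeg g, pdeg_x p} \<union> (\<lambda>j. pdeg (\<phi> j)) ` {1..s})) / 2\<rceil>"

text \<open>The cone \<open>P\<^sup>k(Y)\<close>; the argument \<open>d\<close> is the bound on the degree in y.\<close>

definition P_cone ::
  "nat \<Rightarrow> (real^'n) measure \<Rightarrow> (real^'n) set \<Rightarrow> nat \<Rightarrow> 'n::finite mpoly set" where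
  "P_cone d \<nu> Y k = {\<psi> \<in> polys_le d.
     \<forall>\<sigma>\<in>sos \<inter> polys_le (2 * k). 0 \<le> (LINT y:Y|\<nu>. peval \<psi> y * peval \<sigma> y)}"

definition q1 :: "real \<Rightarrow> 'm::finite mpoly" where
  "q1 R = const (R\<^sup>2) - (\<Sum>i\<in>UNIV. (var i)\<^sup>2)"

definition q2 :: "'m mpoly \<Rightarrow> real \<Rightarrow> 'm mpoly" where
  "q2 g gs = g - const gs"

definition M_cone :: "nat \<Rightarrow> real \<Rightarrow> 'm::finite mpoly \<Rightarrow> real \<Rightarrow> 'm mpoly set" where
  "M_cone d R g gs = {\<sigma>0 + \<sigma>1 * q1 R + \<sigma>2 * q2 g gs | \<sigma>0 \<sigma>1 \<sigma>2.
     \<sigma>0 \<in> sos \<and> \<sigma>1 \<in> sos \<and> \<sigma>2 \<in> sos \<and>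
     pdeg \<sigma>0 \<le> 2 * d \<and> pdeg (\<sigma>1 * q1 R) \<le> 2 * d \<and> pdeg (\<sigma>2 * q2 g gs) \<le> 2 * d}"

definition r_primal ::
  "'m::finite mpoly \<Rightarrow> 'm mpoly \<Rightarrow> nat \<Rightarrow> (nat \<Rightarrow> 'm mpoly) \<Rightarrow> ('m, 'n::finite) mpoly2 \<Rightarrow> (real^'n) set
    \<Rightarrow> (real^'n) measure \<Rightarrow> real \<Rightarrow> real \<Rightarrow> nat \<Rightarrow> ereal" where
  "r_primal f g s \<phi> p Y \<nu> R gs k = Sup {ereal \<rho> | \<rho> H \<eta>.
     H \<in> dual_cone (polys_le (pdeg_y p)) (P_cone (pdeg_y p) \<nu> Y k) \<and>
     (\<forall>j\<in>{1..s}. 0 \<le> (\<eta> :: nat \<Rightarrow> real) j) \<and>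
     f - \<rho> *\<^sub>R g + apply_y H p + (\<Sum>j\<in>{1..s}. \<eta> j *\<^sub>R \<phi> j) \<in> M_cone (half_deg f g s \<phi> p) R g gs}"

definition dual_feasible ::
  "'m::finite mpoly \<Rightarrow> 'm mpoly \<Rightarrow> nat \<Rightarrow> (nat \<Rightarrow> 'm mpoly) \<Rightarrow> ('m, 'n::finite) mpoly2 \<Rightarrow> (real^'n) set
    \<Rightarrow> (real^'n) measure \<Rightarrow> real \<Rightarrow> real \<Rightarrow> nat \<Rightarrow> ('m mpoly \<Rightarrow> real) set" where
  "dual_feasible f g s \<phi> p Y \<nu> R gs k =
     {L \<in> dual_cone (polys_le (2 * half_deg f g s \<phi> p)) (M_cone (half_deg f g s \<phi> p) R g gs).
        L g = 1 \<and> - apply_x L p \<in> P_cone (pdeg_y p) \<nu> Y k \<and> (\<forall>j\<in>{1..s}. L (\<phi> j) \<le> 0)}"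

definition r_dual ::
  "'m::finite mpoly \<Rightarrow> 'm mpoly \<Rightarrow> nat \<Rightarrow> (nat \<Rightarrow> 'm mpoly) \<Rightarrow> ('m, 'n::finite) mpoly2 \<Rightarrow> (real^'n) set
    \<Rightarrow> (real^'n) measure \<Rightarrow> real \<Rightarrow> real \<Rightarrow> nat \<Rightarrow> ereal" where
  "r_dual f g s \<phi> p Y \<nu> R gs k = (INF L\<in>dual_feasible f g s \<phi> p Y \<nu> R gs k. ereal (L f))"

definition dual_minimizer ::
  "'m::finite mpoly \<Rightarrow> 'm mpoly \<Rightarrow> nat \<Rightarrow> (nat \<Rightarrow> 'm mpoly) \<Rightarrow> ('m, 'n::finite) mpoly2 \<Rightarrow> (real^'n) set
    \<Rightarrow> (real^'n) measure \<Rightarrow> real \<Rightarrow> real \<Rightarrow> nat \<Rightarrow> ('m mpoly \<Rightarrow> real) \<Rightarrow> bool" where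
  "dual_minimizer f g s \<phi> p Y \<nu> R gs k L \<longleftrightarrow>
     L \<in> dual_feasible f g s \<phi> p Y \<nu> R gs k \<and> ereal (L f) = r_dual f g s \<phi> p Y \<nu> R gs k"

definition normalized_point :: "('m::finite mpoly \<Rightarrow> real) \<Rightarrow> real^'m" where
  "normalized_point L = (\<chi> i. L (var i) / L 1)"

end

theory Submission
  imports Defs
begin

text \<open>
  The generator \<open>R\<^sup>2 - |x|\<^sup>2\<close> makes \<open>1\<close> an order unit of the truncated quadratic module \<open>M\<close>, and
  \<open>g - gs\<close> bounds \<open>L 1\<close>, so functionals feasible for the dual problem are bounded on every polynomial of
  degree at most \<open>2d\<close>. Hence dual feasible sets are compact, which gives attainment, and the order unit
  lets a positive functional be extended one dimension at a time, which gives strong duality. The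
  moment functionals \<open>\<psi> \<mapsto> \<integral> \<psi> \<sigma> d\<nu>\<close> lie in the dual of \<open>P\<^sup>k(Y)\<close> and define it, so no bipolar theorem is
  needed.

  A limit \<open>G\<close> of dual minimizers is feasible at every level \<open>k\<close>, so \<open>G (p(\<cdot>, y)) \<le> 0\<close> on \<open>Y\<close>. Jensen's
  inequality for sos-convex polynomials then shows that the normalized point of \<open>G\<close> is feasible and that
  its objective value is at most \<open>G f \<le> r\<^sup>*\<close>.
\<close>

text \<open>Every bound on a feasible functional comes from M and \<open>F g = 1\<close> alone, so
  it is uniform in k. One compactness argument therefore serves both a fixed level and the passage
  to infinite k. Functionals are normalized by \<open>F g = 1\<close>, whereas points and Jensen's
  inequality call for \<open>F 1 = 1\<close>. The estimate \<open>0 < F 1 \<le> 1 / gs\<close>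
  bridges the two scales, and the two alternatives of A2 are two ways of comparing the quotient at
  the normalized point of G with \<open>G f\<close> across this change of scale. Duality is read off
  a single cone that collects M and all multipliers: \<rho> is primal feasible iff f - \<rho> g lies
  in it, and dual feasibility is nonnegativity on it together with the normalization. Closedness of
  this cone is not established, so f - \<rho> g is placed in it only for \<rho> strictly below the
  dual value, which is enough for a supremum. Elements of a dual space are linear only within the
  degree bound. The argument works with total linear maps and converts at both ends.\<close>

section \<open>Polynomials as a real algebra\<close>

lemma lookup_scaleR [simp]:
  fixes h :: "'k \<Rightarrow>\<^sub>0 'b::real_vector"
  shows "Poly_Mapping.lookup (c *\<^sub>R h) a = c *\<^sub>R Poly_Mapping.lookup h a"
  by (simp add: scaleR_poly_mapping_def)

text \<open>Scaling is multiplication by a constant polynomial, hence compatible with products. The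
  instance makes \<open>of_real\<close> available for constants.\<close>

instance poly_mapping :: (comm_monoid_add, "{comm_ring_1, real_algebra_1}") real_algebra_1
proof
  fix c :: real and p q :: "'a \<Rightarrow>\<^sub>0 'b"
  have scaleR_eq: "c *\<^sub>R h = Poly_Mapping.single 0 (of_real c) * h" for h :: "'a \<Rightarrow>\<^sub>0 'b"
  proof -
    have "c *\<^sub>R h = Poly_Mapping.map ((*) (of_real c)) h"
      by (rule poly_mapping_eqI)
        (simp add: Poly_Mapping.map.rep_eq when_def, simp add: scaleR_conv_of_real)
    then show ?thesis
      by (simp only: mult_map_scale_conv_mult)
  qed
  show "c *\<^sub>R p * q = c *\<^sub>R (p * q)" "p * c *\<^sub>R q = c *\<^sub>R (p * q)"
    by (simp_all only: scaleR_eq mult_ac)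
qed

lemma keys_scaleR: "Poly_Mapping.keys (c *\<^sub>R h) \<subseteq> Poly_Mapping.keys (h :: 'k \<Rightarrow>\<^sub>0 real)"
  by (auto simp: in_keys_iff)

lemma const_eq_of_real: "(const c :: 'v mpoly) = of_real c"
proof -
  have "(of_real c :: 'v mpoly) = Poly_Mapping.single 0 c"
    by (rule poly_mapping_eqI) (simp add: of_real_def lookup_one lookup_single when_def)
  then show ?thesis
    by (simp add: const_def)
qed

lemma mon_0 [simp]: "mon 0 = 1"
  by (simp add: mon_def)

lemma mon_add: "mon (a + b) = mon a * mon b"
  by (simp add: mon_def mult_single)

lemma single_eq_scaleR_mon: "Poly_Mapping.single a c = c *\<^sub>R mon a"
  by (rule poly_mapping_eqI) (simp add: mon_def lookup_single when_def)

lemma mpoly_expand: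
  fixes h :: "'k \<Rightarrow>\<^sub>0 real"
  shows "h = (\<Sum>a\<in>Poly_Mapping.keys h. Poly_Mapping.lookup h a *\<^sub>R Poly_Mapping.single a 1)"
  by (rule poly_mapping_eqI)
    (simp add: lookup_sum lookup_single when_def in_keys_iff if_distrib cong: if_cong)

text \<open>The linear extension of a map given on the basis of single exponents. Evaluation,
  differentiation, \<open>sub_y\<close>, \<open>apply_x\<close> and \<open>apply_y\<close> are all
  instances, so their linearity is proved once.\<close>

definition lin_ext :: "('k \<Rightarrow> 'b::real_vector) \<Rightarrow> ('k \<Rightarrow>\<^sub>0 real) \<Rightarrow> 'b" where
  "lin_ext c h = (\<Sum>a\<in>Poly_Mapping.keys h. Poly_Mapping.lookup h a *\<^sub>R c a)"

lemma lin_ext_superset: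
  assumes "finite A" "Poly_Mapping.keys h \<subseteq> A"
  shows "lin_ext c h = (\<Sum>a\<in>A. Poly_Mapping.lookup h a *\<^sub>R c a)"
  unfolding lin_ext_def using assms
  by (intro sum.mono_neutral_left) (auto simp: in_keys_iff)

lemma linear_lin_ext: "linear (lin_ext c)"
proof
  fix h q :: "'a \<Rightarrow>\<^sub>0 real" and r :: real
  \<comment> \<open>Cancellation can make the keys of \<open>h + q\<close> smaller than this union,
    so all three sums are compared over the union.\<close>
  let ?A = "Poly_Mapping.keys h \<union> Poly_Mapping.keys q"
  have "lin_ext c (h + q) = (\<Sum>a\<in>?A. Poly_Mapping.lookup (h + q) a *\<^sub>R c a)"
    by (rule lin_ext_superset) (auto dest: keys_add[THEN subsetD])
  also have "\<dots> = lin_ext c h + lin_ext c q"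
    using lin_ext_superset[of ?A h c] lin_ext_superset[of ?A q c]
    by (simp add: lookup_add scaleR_add_left sum.distrib)
  finally show "lin_ext c (h + q) = lin_ext c h + lin_ext c q" .
  have "lin_ext c (r *\<^sub>R h) = (\<Sum>a\<in>Poly_Mapping.keys h. Poly_Mapping.lookup (r *\<^sub>R h) a *\<^sub>R c a)"
    by (rule lin_ext_superset) (auto dest: keys_scaleR[THEN subsetD])
  then show "lin_ext c (r *\<^sub>R h) = r *\<^sub>R lin_ext c h"
    by (simp add: lin_ext_def scaleR_sum_right)
qed

lemma lin_ext_single [simp]: "lin_ext c (Poly_Mapping.single a 1) = c a"
  by (simp add: lin_ext_def)

lemma lin_ext_mon [simp]: "lin_ext c (mon a) = c a"
  by (simp add: mon_def)

lemma linear_expand: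
  assumes "linear F"
  shows "F h = lin_ext (\<lambda>a. F (Poly_Mapping.single a 1)) h"
proof -
  have "F h = F (\<Sum>a\<in>Poly_Mapping.keys h. Poly_Mapping.lookup h a *\<^sub>R Poly_Mapping.single a 1)"
    by (rule arg_cong[OF mpoly_expand])
  then show ?thesis
    by (simp add: lin_ext_def linear_sum[OF assms] linear_scale[OF assms])
qed

lemma linear_eqI_mon:
  assumes "linear F" "linear G" "\<And>a. F (mon a) = G (mon a)"
  shows "F h = G h"
  using assms by (simp add: linear_expand[of F h] linear_expand[of G h] mon_def)

text \<open>Substitution into any commutative real algebra: the target \<open>real\<close> gives
  \<open>peval\<close>, a polynomial ring gives the change of variables \<open>ray\<close>.\<close>

definition aeval :: "('v::finite \<Rightarrow> 'b::{comm_ring_1, real_algebra_1}) \<Rightarrow> 'v mpoly \<Rightarrow> 'b" where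
  "aeval q = lin_ext (\<lambda>a. \<Prod>i\<in>UNIV. q i ^ Poly_Mapping.lookup a i)"

lemma linear_aeval: "linear (aeval q)"
  by (simp add: aeval_def linear_lin_ext)

lemmas aeval_linear_simps [simp] =
  linear_add[OF linear_aeval] linear_diff[OF linear_aeval] linear_neg[OF linear_aeval]
  linear_0[OF linear_aeval] linear_scale[OF linear_aeval] linear_sum[OF linear_aeval]

lemma aeval_mon: "aeval q (mon a) = (\<Prod>i\<in>UNIV. q i ^ Poly_Mapping.lookup a i)"
  by (simp add: aeval_def)

lemma aeval_1 [simp]: "aeval q 1 = 1"
  using aeval_mon[of q 0] by simp

lemma aeval_of_real [simp]: "aeval q (of_real c) = of_real c"
  by (simp add: of_real_def)

lemma aeval_const [simp]: "aeval q (const c) = of_real c"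
  by (simp add: const_eq_of_real)

text \<open>Both sides are linear in each factor, so two rounds of comparison on monomials
  suffice.\<close>

lemma aeval_mult [simp]: "aeval q (h * k) = aeval q h * aeval q k"
proof -
  have mm: "aeval q (mon a * mon b) = aeval q (mon a) * aeval q (mon b)" for a b
    by (simp add: aeval_mon lookup_add power_add prod.distrib flip: mon_add)
  have lin: "linear (\<lambda>k. aeval q (h * k))" "linear (\<lambda>k. aeval q h * aeval q k)"
    "linear (\<lambda>k. aeval q (k * h))" "linear (\<lambda>k. aeval q k * aeval q h)" for h
    by (intro linearI; simp add: ring_distribs)+
  have "aeval q (mon a * k) = aeval q (mon a) * aeval q k" for a
    by (rule linear_eqI_mon[OF lin(1,2)]) (rule mm)
  then show ?thesis
    by (rule linear_eqI_mon[OF lin(3,4)])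
qed

lemma aeval_power [simp]: "aeval q (h ^ n) = aeval q h ^ n"
  by (induction n) simp_all

lemma aeval_var [simp]: "aeval q (var i) = q i"
proof -
  have "aeval q (var i) = (\<Prod>j\<in>UNIV. if j = i then q i else 1)"
    unfolding var_def aeval_mon
    by (intro prod.cong) (auto simp: lookup_single when_def)
  then show ?thesis
    by simp
qed

lemma peval_eq_aeval: "peval h x = aeval (($) x) h"
  by (simp add: peval_def aeval_def lin_ext_def mon_eval_def)

lemma sub_y_eq: "sub_y p y = lin_ext (\<lambda>(a, b). mon_eval b y *\<^sub>R mon a) p"
  by (simp add: sub_y_def lin_ext_def case_prod_beta)

lemma apply_x_eq: "apply_x L p = lin_ext (\<lambda>(a, b). L (mon a) *\<^sub>R mon b) p"
  by (simp add: apply_x_def lin_ext_def case_prod_beta)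

lemma apply_y_eq: "apply_y H p = lin_ext (\<lambda>(a, b). H (mon b) *\<^sub>R mon a) p"
  by (simp add: apply_y_def lin_ext_def case_prod_beta)

lemma partial_eq:
  "partial i = lin_ext (\<lambda>a. real (Poly_Mapping.lookup a i) *\<^sub>R mon (a - Poly_Mapping.single i 1))"
  by (rule ext) (simp add: partial_def lin_ext_def single_eq_scaleR_mon mult.commute)

section \<open>Degrees\<close>

lemma mon_deg_0 [simp]: "mon_deg 0 = 0"
  by (simp add: mon_deg_def)

lemma mon_deg_add [simp]: "mon_deg (a + b) = mon_deg a + mon_deg b"
  by (simp add: mon_deg_def lookup_add sum.distrib)

lemma mon_deg_single [simp]: "mon_deg (Poly_Mapping.single i k) = k"
  by (simp add: mon_deg_def lookup_single when_def)

lemma pdeg_le_iff: "pdeg h \<le> k \<longleftrightarrow> (\<forall>a\<in>Poly_Mapping.keys h. mon_deg a \<le> k)"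
  by (simp add: pdeg_def)

lemma mem_polys_le: "h \<in> polys_le k \<longleftrightarrow> (\<forall>a\<in>Poly_Mapping.keys h. mon_deg a \<le> k)"
  by (simp add: polys_le_def pdeg_le_iff)

lemma subspace_polys_le: "subspace (polys_le k)"
  unfolding subspace_def
  by (auto simp: mem_polys_le dest: keys_add[THEN subsetD] keys_scaleR[THEN subsetD])

lemmas polys_le_closed [simp, intro] =
  subspace_add[OF subspace_polys_le] subspace_diff[OF subspace_polys_le]
  subspace_neg[OF subspace_polys_le] subspace_scale[OF subspace_polys_le]
  subspace_sum[OF subspace_polys_le] subspace_0[OF subspace_polys_le]

lemma polys_le_mono: "h \<in> polys_le j \<Longrightarrow> j \<le> k \<Longrightarrow> h \<in> polys_le k"
  by (auto simp: polys_le_def)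

lemma mon_in_polys_le [simp]: "mon a \<in> polys_le k \<longleftrightarrow> mon_deg a \<le> k"
  by (simp add: mem_polys_le mon_def)

lemma var_in_polys_le [simp]: "var i \<in> polys_le k \<longleftrightarrow> 1 \<le> k"
  by (simp add: var_def)

lemma one_in_polys_le [simp]: "1 \<in> polys_le k"
  using mon_in_polys_le[of 0 k] by simp

lemma const_in_polys_le [simp]: "const c \<in> polys_le k"
  by (simp add: const_eq_of_real of_real_def polys_le_closed)

lemma mult_in_polys_le:
  assumes "h \<in> polys_le j" "q \<in> polys_le k"
  shows "h * q \<in> polys_le (j + k)"
  using assms keys_mult[of h q] unfolding mem_polys_le by (fastforce intro: add_mono)

lemma power_in_polys_le: "h \<in> polys_le j \<Longrightarrow> h ^ n \<in> polys_le (n * j)"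
  by (induction n) (auto simp: mult_in_polys_le)

lemma prod_in_polys_le:
  assumes "finite A" "\<And>i. i \<in> A \<Longrightarrow> h i \<in> polys_le (n i)"
  shows "prod h A \<in> polys_le (sum n A)"
  using assms by (induction A rule: finite_induct) (auto intro: mult_in_polys_le)

lemma lin_ext_in_subspace:
  assumes "subspace W" "\<And>a. a \<in> Poly_Mapping.keys h \<Longrightarrow> c a \<in> W"
  shows "lin_ext c h \<in> W"
  unfolding lin_ext_def using assms by (auto intro!: subspace_sum subspace_scale)

lemma aeval_in_polys_le:
  assumes "\<And>i. q i \<in> polys_le 1" "h \<in> polys_le k"
  shows "aeval q h \<in> polys_le k"
  unfolding aeval_def
proof (rule lin_ext_in_subspace[OF subspace_polys_le])
  fix a assume "a \<in> Poly_Mapping.keys h"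
  have "(\<Prod>i\<in>UNIV. q i ^ Poly_Mapping.lookup a i) \<in> polys_le (mon_deg a)"
    unfolding mon_deg_def using power_in_polys_le[OF assms(1)]
    by (intro prod_in_polys_le) auto
  then show "(\<Prod>i\<in>UNIV. q i ^ Poly_Mapping.lookup a i) \<in> polys_le k"
    using \<open>a \<in> _\<close> assms(2) by (auto simp: mem_polys_le[of h] intro: polys_le_mono)
qed

lemma lin_ext_mon_ident [simp]: "lin_ext mon h = h"
  by (rule linear_eqI_mon) (auto simp: linear_lin_ext linear_id[unfolded id_def])

lemma polys_le_eq_span: "(polys_le k :: 'v::finite mpoly set) = span (mon ` {a. mon_deg a \<le> k})"
proof
  show "span (mon ` {a :: 'v \<Rightarrow>\<^sub>0 nat. mon_deg a \<le> k}) \<subseteq> polys_le k"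
    by (rule span_minimal) (auto simp: subspace_polys_le)
  show "polys_le k \<subseteq> span (mon ` {a :: 'v \<Rightarrow>\<^sub>0 nat. mon_deg a \<le> k})"
  proof
    fix h :: "'v mpoly" assume "h \<in> polys_le k"
    then have "lin_ext mon h \<in> span (mon ` {a. mon_deg a \<le> k})"
      by (intro lin_ext_in_subspace) (auto simp: mem_polys_le intro: span_base)
    then show "h \<in> span (mon ` {a. mon_deg a \<le> k})"
      by simp
  qed
qed

lemma finite_mon_deg_le: "finite {a :: 'v::finite \<Rightarrow>\<^sub>0 nat. mon_deg a \<le> k}"
proof (rule finite_imageD)
  have "Poly_Mapping.lookup a i \<le> mon_deg a" for a :: "'v \<Rightarrow>\<^sub>0 nat" and i
    unfolding mon_deg_def by (rule member_le_sum) auto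
  then have "Poly_Mapping.lookup ` {a :: 'v \<Rightarrow>\<^sub>0 nat. mon_deg a \<le> k} \<subseteq> (UNIV \<rightarrow>\<^sub>E {..k})"
    by (auto intro: order_trans)
  then show "finite (Poly_Mapping.lookup ` {a :: 'v \<Rightarrow>\<^sub>0 nat. mon_deg a \<le> k})"
    by (rule finite_subset) (auto intro: finite_PiE)
  show "inj_on Poly_Mapping.lookup {a :: 'v \<Rightarrow>\<^sub>0 nat. mon_deg a \<le> k}"
    by (auto intro: inj_onI)
qed

lemma mon_deg_Suc_split:
  assumes "mon_deg b \<noteq> 0"
  obtains i c where "b = Poly_Mapping.single i 1 + c"
proof -
  obtain i where "Poly_Mapping.lookup b i \<noteq> 0"
    using assms by (auto simp: mon_deg_def)
  then have "b = Poly_Mapping.single i 1 + (b - Poly_Mapping.single i 1)"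
    by (intro poly_mapping_eqI) (auto simp: lookup_add lookup_minus lookup_single when_def)
  then show ?thesis
    by (rule that)
qed

text \<open>Used to write a monomial of degree at most 2d as a product of two of degree at most d,
  whose squares still respect the degree bound.\<close>

lemma mon_split: "j \<le> mon_deg c \<Longrightarrow> \<exists>a b. c = a + b \<and> mon_deg a = j"
proof (induction j)
  case 0
  then show ?case
    by (intro exI[of _ 0] exI[of _ c]) simp
next
  case (Suc j)
  then obtain a b where c: "c = a + b" "mon_deg a = j"
    by auto
  then have "mon_deg b \<noteq> 0"
    using Suc.prems by simp
  then obtain i b' where "b = Poly_Mapping.single i 1 + b'"
    by (rule mon_deg_Suc_split)
  then have "c = (a + Poly_Mapping.single i 1) + b'" "mon_deg (a + Poly_Mapping.single i 1) = Suc j"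
    using c by (simp_all add: add.assoc)
  then show ?case
    by blast
qed

section \<open>Sums of squares and the truncated quadratic module\<close>

lemma sos_0 [simp]: "0 \<in> sos"
  by (auto simp: sos_def intro!: exI[of _ "0::nat"])

lemma sos_square [simp]: "h\<^sup>2 \<in> sos"
  by (auto simp: sos_def intro!: exI[of _ "1::nat"] exI[of _ "\<lambda>_. h"])

lemma sos_add:
  assumes "h \<in> sos" "h' \<in> sos"
  shows "h + h' \<in> sos"
proof -
  obtain r r' :: nat and q q' where h: "h = (\<Sum>l<r. (q l)\<^sup>2)" "h' = (\<Sum>l<r'. (q' l)\<^sup>2)"
    using assms unfolding sos_def by blast
  define w where "w l = (if l < r then q l else q' (l - r))" for l
  have "(\<Sum>l<r + k. (w l)\<^sup>2) = (\<Sum>l<r. (w l)\<^sup>2) + (\<Sum>l<k. (w (r + l))\<^sup>2)" for k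
    by (induction k) (simp_all add: add_ac)
  from this[of r'] have "h + h' = (\<Sum>l<r + r'. (w l)\<^sup>2)"
    by (simp add: h w_def)
  then show ?thesis
    by (auto simp: sos_def)
qed

lemma sos_scaleR:
  assumes "h \<in> sos" "0 \<le> c"
  shows "c *\<^sub>R h \<in> (sos :: 'v mpoly set)"
proof -
  obtain r :: nat and q where h: "h = (\<Sum>l<r. (q l)\<^sup>2)"
    using assms unfolding sos_def by blast
  have "c *\<^sub>R h = (\<Sum>l<r. (sqrt c *\<^sub>R q l)\<^sup>2)"
    using assms(2) by (simp add: h scaleR_sum_right power2_eq_square)
  then show ?thesis
    by (auto simp: sos_def)
qed

lemma sos_sum: "(\<And>i. i \<in> A \<Longrightarrow> h i \<in> sos) \<Longrightarrow> sum h A \<in> sos"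
  by (induction A rule: infinite_finite_induct) (auto intro: sos_add)

lemma peval_sos_nonneg: "\<sigma> \<in> sos \<Longrightarrow> 0 \<le> peval \<sigma> x"
  by (auto simp: sos_def peval_eq_aeval intro!: sum_nonneg)

lemma mem_M_cone:
  "h \<in> M_cone d R g gs \<longleftrightarrow> (\<exists>\<sigma>0 \<sigma>1 \<sigma>2. h = \<sigma>0 + \<sigma>1 * q1 R + \<sigma>2 * q2 g gs \<and>
     \<sigma>0 \<in> sos \<and> \<sigma>1 \<in> sos \<and> \<sigma>2 \<in> sos \<and> \<sigma>0 \<in> polys_le (2 * d) \<and>
     \<sigma>1 * q1 R \<in> polys_le (2 * d) \<and> \<sigma>2 * q2 g gs \<in> polys_le (2 * d))"
  by (auto simp: M_cone_def polys_le_def)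

lemma M_cone_add:
  assumes "h \<in> M_cone d R g gs" "h' \<in> M_cone d R g gs"
  shows "h + h' \<in> M_cone d R g gs"
proof -
  obtain \<sigma>0 \<sigma>1 \<sigma>2 where 1: "h = \<sigma>0 + \<sigma>1 * q1 R + \<sigma>2 * q2 g gs"
     "\<sigma>0 \<in> sos" "\<sigma>1 \<in> sos" "\<sigma>2 \<in> sos" "\<sigma>0 \<in> polys_le (2 * d)"
     "\<sigma>1 * q1 R \<in> polys_le (2 * d)" "\<sigma>2 * q2 g gs \<in> polys_le (2 * d)"
    using assms(1) unfolding mem_M_cone by blast
  obtain \<tau>0 \<tau>1 \<tau>2 where 2: "h' = \<tau>0 + \<tau>1 * q1 R + \<tau>2 * q2 g gs"
     "\<tau>0 \<in> sos" "\<tau>1 \<in> sos" "\<tau>2 \<in> sos" "\<tau>0 \<in> polys_le (2 * d)"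
     "\<tau>1 * q1 R \<in> polys_le (2 * d)" "\<tau>2 * q2 g gs \<in> polys_le (2 * d)"
    using assms(2) unfolding mem_M_cone by blast
  show ?thesis
    unfolding mem_M_cone
    by (rule exI[of _ "\<sigma>0 + \<tau>0"], rule exI[of _ "\<sigma>1 + \<tau>1"], rule exI[of _ "\<sigma>2 + \<tau>2"])
      (use 1 2 in \<open>auto simp: ring_distribs intro: sos_add\<close>)
qed

lemma M_cone_scaleR:
  assumes "h \<in> M_cone d R g gs" "0 \<le> c"
  shows "c *\<^sub>R h \<in> M_cone d R g gs"
proof -
  obtain \<sigma>0 \<sigma>1 \<sigma>2 where 1: "h = \<sigma>0 + \<sigma>1 * q1 R + \<sigma>2 * q2 g gs"
     "\<sigma>0 \<in> sos" "\<sigma>1 \<in> sos" "\<sigma>2 \<in> sos" "\<sigma>0 \<in> polys_le (2 * d)"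
     "\<sigma>1 * q1 R \<in> polys_le (2 * d)" "\<sigma>2 * q2 g gs \<in> polys_le (2 * d)"
    using assms(1) unfolding mem_M_cone by blast
  show ?thesis
    unfolding mem_M_cone
    by (rule exI[of _ "c *\<^sub>R \<sigma>0"], rule exI[of _ "c *\<^sub>R \<sigma>1"], rule exI[of _ "c *\<^sub>R \<sigma>2"])
      (use 1 assms(2) in \<open>auto simp: scaleR_add_right intro: sos_scaleR\<close>)
qed

lemma sos_in_M_cone: "\<sigma> \<in> sos \<Longrightarrow> \<sigma> \<in> polys_le (2 * d) \<Longrightarrow> \<sigma> \<in> M_cone d R g gs"
  unfolding mem_M_cone by (rule exI[of _ \<sigma>], rule exI[of _ 0], rule exI[of _ 0]) auto

lemma q1_in_M_cone:
  "\<sigma> \<in> sos \<Longrightarrow> \<sigma> * q1 R \<in> polys_le (2 * d) \<Longrightarrow> \<sigma> * q1 R \<in> M_cone d R g gs"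
  unfolding mem_M_cone by (rule exI[of _ 0], rule exI[of _ \<sigma>], rule exI[of _ 0]) auto

lemma q2_in_M_cone:
  assumes "g \<in> polys_le (2 * d)"
  shows "q2 g gs \<in> M_cone d R g gs"
proof -
  have "1 \<in> (sos :: 'a mpoly set)"
    using sos_square[of 1] by simp
  then show ?thesis
    unfolding mem_M_cone using assms
    by (intro exI[of _ 0] exI[of _ 0] exI[of _ 1]) (auto simp: q2_def)
qed

lemma q1_in_polys_le: "q1 R \<in> polys_le 2"
proof -
  have "(var i)\<^sup>2 \<in> polys_le 2" for i :: 'a
    using power_in_polys_le[of "var i" 1 2] by simp
  then show ?thesis
    unfolding q1_def by auto
qed

lemma M_cone_subset_polys_le: "M_cone d R g gs \<subseteq> polys_le (2 * d)"
  by (auto simp: mem_M_cone)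

text \<open>This is why evaluation at the prescribed optimal point is nonnegative on M.\<close>

lemma peval_M_cone_nonneg:
  assumes "h \<in> M_cone d R g gs" "norm x \<le> R" "gs \<le> peval g x"
  shows "0 \<le> peval h x"
proof -
  have "(norm x)\<^sup>2 \<le> R\<^sup>2"
    using assms(2) by (intro power_mono) auto
  then have "0 \<le> peval (q1 R) x"
    by (simp add: q1_def peval_eq_aeval norm_vec_def L2_set_def sum_nonneg)
  moreover have "0 \<le> peval (q2 g gs) x"
    using assms(3) by (simp add: q2_def peval_eq_aeval)
  ultimately show ?thesis
    using assms(1) peval_sos_nonneg[of _ x] by (auto simp: mem_M_cone peval_eq_aeval)
qed

text \<open>On the ball a squared monomial of degree n is at most R^(2n). The certificate trades one
  variable at a time for a factor R^2: a multiple of \<open>q1 R\<close> does the exchange, and the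
  squares involving the other variables are added back.\<close>

lemma M_cone_bounds_squares:
  assumes "mon_deg a \<le> d"
  shows "\<exists>t. of_real t - mon (a + a) \<in> M_cone d R g gs"
  using assms
proof (induction "mon_deg a" arbitrary: a)
  case 0
  have "of_real 1 - mon (a + a) = (0 :: 'a mpoly)"
  proof -
    have "a = 0"
      using 0(1) by (intro poly_mapping_eqI) (auto simp: mon_deg_def)
    then show ?thesis
      by simp
  qed
  moreover have "0 \<in> M_cone d R g gs"
    by (rule sos_in_M_cone) auto
  ultimately show ?case
    by metis
next
  case (Suc n)
  then obtain i b where a: "a = Poly_Mapping.single i 1 + b"
    by (metis mon_deg_Suc_split nat.distinct(1))
  with Suc have b: "mon_deg b = n" "n < d"
    by auto
  then obtain t where t: "of_real t - mon (b + b) \<in> M_cone d R g gs"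
    using Suc(1)[of b] by auto
  let ?rest = "\<Sum>j\<in>UNIV - {i}. (mon b * var j)\<^sup>2"
  have dvar: "mon b * var j \<in> polys_le d" for j
    using mult_in_polys_le[of "mon b" n "var j" 1] b by (auto intro: polys_le_mono)
  have "?rest \<in> M_cone d R g gs"
    using power_in_polys_le[OF dvar, where n = 2] by (intro sos_in_M_cone sos_sum) auto
  moreover have "(mon b)\<^sup>2 * q1 R \<in> M_cone d R g gs"
  proof (rule q1_in_M_cone)
    have "(mon b)\<^sup>2 * q1 R \<in> polys_le (2 * n + 2)"
      using b by (intro mult_in_polys_le power_in_polys_le q1_in_polys_le) auto
    then show "(mon b)\<^sup>2 * q1 R \<in> polys_le (2 * d)"
      using b by (auto intro: polys_le_mono)
  qed auto
  moreover have "of_real (R\<^sup>2 * t) - mon (a + a)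
      = R\<^sup>2 *\<^sub>R (of_real t - mon (b + b)) + (mon b)\<^sup>2 * q1 R + ?rest"
  proof -
    have "(\<Sum>j\<in>UNIV. (var j)\<^sup>2 :: 'a mpoly) = (var i)\<^sup>2 + (\<Sum>j\<in>UNIV - {i}. (var j)\<^sup>2)"
      by (subst sum.remove[of _ i]) auto
    moreover have "mon (a + a) = (mon b)\<^sup>2 * (var i)\<^sup>2"
      by (simp add: a mon_add var_def power2_eq_square mult_ac)
    moreover have "?rest = (mon b)\<^sup>2 * (\<Sum>j\<in>UNIV - {i}. (var j)\<^sup>2)"
      by (simp add: sum_distrib_left power_mult_distrib)
    ultimately show ?thesis
      by (simp add: q1_def const_eq_of_real mon_add scaleR_conv_of_real power2_eq_square algebra_simps)
  qed
  ultimately have "of_real (R\<^sup>2 * t) - mon (a + a) \<in> M_cone d R g gs"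
    using t by (simp only: M_cone_add M_cone_scaleR zero_le_power2)
  then show ?case ..
qed

text \<open>Polarization: the square of x^a + e x^b, with e = 1 or e = -1, bounds the mixed term by
  the two pure squares, which are bounded already.\<close>

lemma M_cone_bounds_monomials:
  assumes "mon_deg c \<le> 2 * d"
  shows "\<exists>t. of_real t + r *\<^sub>R mon c \<in> M_cone d R g gs"
proof -
  \<comment> \<open>The minimum keeps both halves at degree at most d, also when c itself has degree
    below d.\<close>
  obtain a b where c: "c = a + b" "mon_deg a = min d (mon_deg c)"
    using mon_split[of "min d (mon_deg c)" c] by auto
  then have ab: "mon_deg a \<le> d" "mon_deg b \<le> d"
    using assms by auto
  obtain t u where t: "of_real t - mon (a + a) \<in> M_cone d R g gs"
    and u: "of_real u - mon (b + b) \<in> M_cone d R g gs"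
    using M_cone_bounds_squares[OF ab(1)] M_cone_bounds_squares[OF ab(2)] by blast
  \<comment> \<open>The sign of r, set to 1 at r = 0 so that \<open>e * e = 1\<close> always
    holds.\<close>
  define e :: real where "e = (if 0 \<le> r then 1 else -1)"
  have e: "e * e = 1" "\<bar>r\<bar> * e = r"
    by (auto simp: e_def)
  have "(mon a + e *\<^sub>R mon b)\<^sup>2 \<in> M_cone d R g gs"
    using ab power_in_polys_le[of "mon a + e *\<^sub>R mon b" d 2] by (intro sos_in_M_cone) auto
  then have "(\<bar>r\<bar> / 2) *\<^sub>R ((of_real t - mon (a + a)) + (of_real u - mon (b + b)) + (mon a + e *\<^sub>R mon b)\<^sup>2)
    \<in> M_cone d R g gs"
    using t u by (intro M_cone_scaleR M_cone_add) auto
  moreover have "(\<bar>r\<bar> / 2) *\<^sub>R ((of_real t - mon (a + a)) + (of_real u - mon (b + b)) + (mon a + e *\<^sub>R mon b)\<^sup>2)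
    = of_real (\<bar>r\<bar> / 2 * (t + u)) + (\<bar>r\<bar> * e) *\<^sub>R mon c"
  proof -
    have "(mon a + e *\<^sub>R mon b)\<^sup>2 = mon (a + a) + mon (b + b) + (2 * e) *\<^sub>R mon c"
    proof -
      have "(2 * e) *\<^sub>R mon c = e *\<^sub>R mon c + e *\<^sub>R mon c"
        by (simp flip: scaleR_add_left)
      then show ?thesis
        by (simp only: c(1) mon_add power2_eq_square ring_distribs mult_scaleR_left mult_scaleR_right
            scaleR_add_right scaleR_scaleR e scaleR_one) (simp only: add_ac mult.commute)
    qed
    then show ?thesis
      by (simp add: of_real_def scaleR_add_right scaleR_add_left ring_distribs add_divide_distrib)
  qed
  ultimately show ?thesis
    unfolding e by metis
qed

lemma M_cone_order_unit:
  assumes "h \<in> polys_le (2 * d)"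
  shows "\<exists>t. of_real t + h \<in> M_cone d R g gs"
proof -
  have "\<exists>t. of_real t + (\<Sum>a\<in>A. Poly_Mapping.lookup h a *\<^sub>R mon a) \<in> M_cone d R g gs"
    if "finite A" "A \<subseteq> Poly_Mapping.keys h" for A
    using that
  proof (induction A rule: finite_induct)
    case empty
    have "of_real 0 + 0 \<in> M_cone d R g gs"
      by (rule sos_in_M_cone) auto
    then show ?case
      by (metis sum.empty)
  next
    case (insert a A)
    then have "mon_deg a \<le> 2 * d"
      using assms by (auto simp: mem_polys_le)
    then obtain t u where
      "of_real t + Poly_Mapping.lookup h a *\<^sub>R mon a \<in> M_cone d R g gs"
      "of_real u + (\<Sum>a\<in>A. Poly_Mapping.lookup h a *\<^sub>R mon a) \<in> M_cone d R g gs"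
      using M_cone_bounds_monomials[of a d] insert by blast
    from M_cone_add[OF this]
    have "of_real (t + u) + (\<Sum>a\<in>insert a A. Poly_Mapping.lookup h a *\<^sub>R mon a) \<in> M_cone d R g gs"
      using insert by (simp add: algebra_simps)
    then show ?case ..
  qed
  from this[of "Poly_Mapping.keys h"] show ?thesis
    using lin_ext_mon_ident[of h] by (simp add: lin_ext_def)
qed

section \<open>Extension of positive functionals\<close>

text \<open>The M. Riesz extension argument, one generator at a time. The order unit
  \<open>e\<close> plays the part that an interior point has in a separation theorem.\<close>

lemma positive_functional_exists:
  fixes N :: "'a::real_vector set"
  assumes add: "\<And>x y. x \<in> N \<Longrightarrow> y \<in> N \<Longrightarrow> x + y \<in> N"
    and scale: "\<And>c x. 0 \<le> c \<Longrightarrow> x \<in> N \<Longrightarrow> c *\<^sub>R x \<in> N"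
    and proper: "- e \<notin> N"
    and "finite B"
    and "\<And>v. v \<in> span (insert e B) \<Longrightarrow> \<exists>t. t *\<^sub>R e + v \<in> N"
  shows "\<exists>F :: 'a \<Rightarrow> real. linear F \<and> F e = 1 \<and> (\<forall>v\<in>N \<inter> span (insert e B). 0 \<le> F v)"
  using assms(4,5)
proof (induction B rule: finite_induct)
  case empty
  have "e \<noteq> 0"
  proof
    assume "e = 0"
    obtain t where "t *\<^sub>R e + 0 \<in> N"
      using empty[OF span_0] ..
    then show False
      using proper \<open>e = 0\<close> by simp
  qed
  then obtain F where F: "linear F" "F e = (1::real)"
    using linear_independent_extend[of "{e}" "\<lambda>_. 1 :: real"] by auto
  have "0 \<le> F v" if v: "v \<in> N" "v \<in> span {e}" for v
  proof (rule ccontr)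
    assume "\<not> 0 \<le> F v"
    obtain k where k: "v = k *\<^sub>R e"
      using v(2) by (auto simp: span_singleton)
    then have "k < 0"
      using \<open>\<not> 0 \<le> F v\<close> F by (simp add: linear_scale)
    then have "- e = (- (1 / k)) *\<^sub>R v"
      by (simp add: k)
    then show False
      using scale[of "- (1 / k)" v] v \<open>k < 0\<close> proper by simp
  qed
  then show ?case
    using F by (intro exI[of _ F]) auto
next
  case (insert w B)
  let ?U = "span (insert e B)"
  have U_sub: "?U \<subseteq> span (insert e (insert w B))"
    by (rule span_mono) auto
  obtain F :: "'a \<Rightarrow> real" where F: "linear F" "F e = 1" "\<And>v. v \<in> N \<Longrightarrow> v \<in> ?U \<Longrightarrow> 0 \<le> F v"
    using insert.IH insert.prems U_sub by blast
  show ?case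
  proof (cases "w \<in> ?U")
    case True
    then have "span (insert w (insert e B)) = ?U"
      by (rule span_redundant)
    then show ?thesis
      using F by (auto simp: insert_commute)
  next
    case False
    obtain B0 where B0: "B0 \<subseteq> ?U" "independent B0" "?U \<subseteq> span B0"
      by (rule basis_exists)
    then have "span B0 = ?U"
      by (metis span_eq span_span span_superset subset_antisym span_mono)
    with False have "w \<notin> span B0"
      by simp
    with B0 have "independent (insert w B0)"
      by (simp add: independent_insertI)
    from linear_independent_extend[OF this, of "\<lambda>x. if x = w then 1 else 0 :: real"]
    obtain G where G: "linear G" "\<forall>x\<in>insert w B0. G x = (if x = w then 1 else 0 :: real)"
      by blast
    have Gw: "G w = 1"
      using G by simp
    have GU: "G u = 0" if "u \<in> ?U" for u
    proof (rule linear_eq_0_on_span[OF G(1)])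
      show "G x = 0" if "x \<in> B0" for x
        using that G \<open>w \<notin> span B0\<close> by (auto intro: span_base)
      show "u \<in> span B0"
        using that \<open>span B0 = ?U\<close> by simp
    qed
    \<comment> \<open>The value at \<open>w\<close> must be at least F on every \<open>a\<close>
      with \<open>w - a \<in> N\<close> and at most F on every \<open>b\<close> with
      \<open>b - w \<in> N\<close>. The supremum \<open>c\<close> is the least admissible
      choice.\<close>
    define D where "D = F ` {a \<in> ?U. w - a \<in> N}"
    define c where "c = Sup D"
    have w: "w \<in> span (insert e (insert w B))"
      by (simp add: span_base)
    have e: "e \<in> ?U"
      by (simp add: span_base)
    have between: "F a \<le> F b" if "a \<in> ?U" "b \<in> ?U" "w - a \<in> N" "b - w \<in> N" for a b
    proof -
      have "b - a \<in> N"
        using add[OF that(3,4)] by simp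
      then show ?thesis
        using F(3)[of "b - a"] that F(1) by (simp add: span_diff linear_diff)
    qed
    \<comment> \<open>The order unit property for \<open>w\<close> makes \<open>D\<close> nonempty;
      for \<open>- w\<close> it bounds \<open>D\<close> above.\<close>
    obtain t where t: "t *\<^sub>R e + w \<in> N"
      using insert.prems[OF w] ..
    have "F (- (t *\<^sub>R e)) \<in> D"
      using t e unfolding D_def by (intro imageI) (auto simp: span_neg span_scale add.commute)
    then have "D \<noteq> {}"
      by auto
    obtain s where s: "s *\<^sub>R e + - w \<in> N"
      using insert.prems[OF span_neg[OF w]] ..
    have s_up: "x \<le> F (s *\<^sub>R e)" if "x \<in> D" for x
      using that between[of _ "s *\<^sub>R e"] s e by (auto simp: D_def span_scale)
    have c_up: "F a \<le> c" if "a \<in> ?U" "w - a \<in> N" for a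
      unfolding c_def using that s_up by (intro cSup_upper) (auto simp: D_def intro!: bdd_aboveI)
    have c_low: "c \<le> F b" if "b \<in> ?U" "b - w \<in> N" for b
      unfolding c_def using that between by (intro cSup_least \<open>D \<noteq> {}\<close>) (auto simp: D_def)
    \<comment> \<open>F is already defined at \<open>w\<close>, but with an uncontrolled value. G
      vanishes on the old span and is 1 at \<open>w\<close>, so the correction changes that value to
      \<open>c\<close> and nothing on the old span.\<close>
    define F' where "F' v = F v + (c - F w) * G v" for v
    have linF': "linear F'"
      unfolding F'_def using F(1) G(1)
      by (intro linearI) (simp_all add: linear_add linear_scale algebra_simps)
    have "F' e = 1"
      using F GU[OF e] by (simp add: F'_def)
    moreover have "0 \<le> F' v" if v: "v \<in> N" "v \<in> span (insert e (insert w B))" for v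
    proof -
      obtain k where k: "v - k *\<^sub>R w \<in> ?U"
        using v(2) by (auto simp: insert_commute[of e w] span_breakdown_eq)
      define u where "u = v - k *\<^sub>R w"
      have u: "u \<in> ?U" "v = u + k *\<^sub>R w"
        using k by (auto simp: u_def)
      have F'v: "F' v = F u + k * c"
        using F(1) G(1) GU[OF u(1)] Gw
        by (simp add: F'_def u(2) linear_add linear_scale algebra_simps)
      \<comment> \<open>After division by the absolute value of k, \<open>v\<close> has the form
        \<open>w - a\<close> or \<open>b - w\<close> with \<open>a\<close>, \<open>b\<close> in the
        old span, so the two bounds on \<open>c\<close> apply.\<close>
      consider "k = 0" | "k > 0" | "k < 0"
        by linarith
      then show ?thesis
      proof cases
        case 1
        then show ?thesis
          using F(3)[of u] u v F'v by simp
      next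
        case 2
        have "w - (- (1 / k)) *\<^sub>R u = (1 / k) *\<^sub>R v"
          using 2 by (simp add: u(2) scaleR_add_right)
        then have "F ((- (1 / k)) *\<^sub>R u) \<le> c"
          using scale[of "1 / k" v] v 2 u by (intro c_up) (auto simp: span_scale span_neg)
        then show ?thesis
          using 2 F(1) by (simp add: F'v linear_scale linear_neg field_simps)
      next
        case 3
        have "(- (1 / k)) *\<^sub>R u - w = (- (1 / k)) *\<^sub>R v"
          using 3 by (simp add: u(2) scaleR_add_right)
        then have "c \<le> F ((- (1 / k)) *\<^sub>R u)"
          using scale[of "- (1 / k)" v] v 3 u by (intro c_low) (auto simp: span_scale span_neg)
        then show ?thesis
          using 3 F(1) by (simp add: F'v linear_scale linear_neg field_simps)
      qed
    qed
    ultimately show ?thesis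
      using linF' by blast
  qed
qed

section \<open>Linear functionals on polynomials of bounded degree\<close>

text \<open>Bolzano-Weierstrass one coordinate at a time. Applied to the finitely many monomials of
  bounded degree, it gives compactness without a topology on functionals.\<close>

lemma pointwise_bounded_subsequence:
  fixes x :: "nat \<Rightarrow> 'a \<Rightarrow> real"
  assumes "finite T" "\<And>a k. a \<in> T \<Longrightarrow> \<bar>x k a\<bar> \<le> C a"
  shows "\<exists>r l. strict_mono r \<and> (\<forall>a\<in>T. (\<lambda>k. x (r k) a) \<longlonglongrightarrow> l a)"
  using assms
proof (induction T rule: finite_induct)
  case empty
  then show ?case
    by (auto intro: exI[of _ id] strict_mono_id)
next
  case (insert b T)
  then obtain r l where r: "strict_mono r" "\<forall>a\<in>T. (\<lambda>k. x (r k) a) \<longlonglongrightarrow> l a"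
    by blast
  have "bounded (range (\<lambda>k. x (r k) b))"
    using insert.prems[of b] by (auto simp: bounded_iff)
  then obtain m r' where r': "strict_mono r'" "((\<lambda>k. x (r k) b) \<circ> r') \<longlonglongrightarrow> m"
    using bounded_imp_convergent_subsequence by blast
  have "(\<lambda>k. x (r (r' k)) a) \<longlonglongrightarrow> (l(b := m)) a" if "a \<in> insert b T" for a
  proof (cases "a = b")
    case True
    then show ?thesis
      using r'(2) by (simp add: comp_def)
  next
    case False
    then have "(\<lambda>k. x (r k) a) \<longlonglongrightarrow> l a"
      using r that by auto
    from LIMSEQ_subseq_LIMSEQ[OF this r'(1)] show ?thesis
      using False by (simp add: comp_def)
  qed
  then show ?case
    using strict_mono_o[OF r(1) r'(1)]
    by (intro exI[of _ "\<lambda>k. r (r' k)"] exI[of _ "l(b := m)"]) (simp add: comp_def)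
qed

lemma lin_ext_compose:
  assumes "linear F"
  shows "F (lin_ext c h) = lin_ext (\<lambda>a. F (c a)) h"
  by (simp add: lin_ext_def linear_sum[OF assms] linear_scale[OF assms])

text \<open>With total linear maps the linearity laws hold without degree side conditions.\<close>

lemma dual_space_linear_ext:
  fixes L :: "'v::finite mpoly \<Rightarrow> real"
  assumes "L \<in> dual_space (polys_le D)"
  obtains F where "linear F" "\<And>h. h \<in> polys_le D \<Longrightarrow> F h = L h"
proof
  \<comment> \<open>The value 0 above degree \<open>D\<close> is a mere default.\<close>
  let ?F = "lin_ext (\<lambda>a. if mon_deg a \<le> D then L (mon a) else 0)"
  show "linear ?F"
    by (rule linear_lin_ext)
  fix h :: "'v mpoly" assume "h \<in> polys_le D"
  then have "h \<in> span (mon ` {a. mon_deg a \<le> D})"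
    by (simp add: polys_le_eq_span)
  then have "h \<in> polys_le D \<and> ?F h = L h"
  proof (induction h rule: span_induct)
    case base
    have "L (0 *\<^sub>R 0) = 0 * L 0"
      using assms unfolding dual_space_def by blast
    moreover have "L (x + y) = L x + L y" "L (c *\<^sub>R x) = c * L x"
      if "x \<in> polys_le D" "y \<in> polys_le D" for x y c
      using assms that unfolding dual_space_def by blast+
    ultimately show ?case
      by (auto simp: subspace_def linear_add linear_scale linear_0 linear_lin_ext)
  next
    case (step x)
    then show ?case
      by auto
  qed
  then show "?F h = L h" ..
qed

lemma restrict_linear_in_dual_space:
  "linear F \<Longrightarrow> restrict F (polys_le D) \<in> dual_space (polys_le D)"
  by (auto simp: dual_space_def linear_add linear_scale)

lemma apply_x_cong:
  assumes "pdeg_x p \<le> D" "\<And>h. h \<in> polys_le D \<Longrightarrow> F h = L h"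
  shows "apply_x F p = apply_x L p"
proof -
  have "F (mon a) = L (mon a)" if "(a, b) \<in> Poly_Mapping.keys p" for a b
  proof -
    have "mon_deg a \<le> D"
      using assms(1) that by (force simp: pdeg_x_def)
    then show ?thesis
      by (simp add: assms(2))
  qed
  then show ?thesis
    unfolding apply_x_def by (intro sum.cong) auto
qed

lemma apply_y_cong:
  assumes "pdeg_y p \<le> D" "\<And>h. h \<in> polys_le D \<Longrightarrow> F h = L h"
  shows "apply_y F p = apply_y L p"
proof -
  have "F (mon b) = L (mon b)" if "(a, b) \<in> Poly_Mapping.keys p" for a b
  proof -
    have "mon_deg b \<le> D"
      using assms(1) that by (force simp: pdeg_y_def)
    then show ?thesis
      by (simp add: assms(2))
  qed
  then show ?thesis
    unfolding apply_y_def by (intro sum.cong) auto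
qed

lemma apply_x_in_polys_le: "apply_x L p \<in> polys_le (pdeg_y p)"
  unfolding apply_x_eq
  by (rule lin_ext_in_subspace[OF subspace_polys_le]) (auto simp: pdeg_y_def intro!: polys_le_closed Max_ge)

lemma apply_y_in_polys_le: "apply_y L p \<in> polys_le (pdeg_x p)"
  unfolding apply_y_eq
  by (rule lin_ext_in_subspace[OF subspace_polys_le]) (auto simp: pdeg_x_def intro!: polys_le_closed Max_ge)

lemma sub_y_in_polys_le: "sub_y p y \<in> polys_le (pdeg_x p)"
  unfolding sub_y_eq
  by (rule lin_ext_in_subspace[OF subspace_polys_le]) (auto simp: pdeg_x_def intro!: polys_le_closed Max_ge)

text \<open>An algebraic Fubini theorem. It is the adjointness that makes the two relaxations dual
  to each other.\<close>

lemma apply_x_apply_y: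
  assumes "linear F" "linear H"
  shows "F (apply_y H p) = H (apply_x F p)"
  unfolding apply_x_eq apply_y_eq
  by (simp add: lin_ext_compose assms linear_scale case_prod_beta mult.commute)

lemma linear_peval: "linear (\<lambda>h. peval h x)"
  by (simp add: peval_eq_aeval linear_aeval)

lemma peval_mon: "peval (mon a) x = mon_eval a x"
  by (simp add: peval_eq_aeval aeval_mon mon_eval_def)

text \<open>The case where the functional in y is evaluation at a point: it translates between the
  polynomial \<open>apply_x F p\<close> and the single constraints p(., y).\<close>

lemma linear_sub_y:
  assumes "linear F"
  shows "F (sub_y p y) = peval (apply_x F p) y"
proof -
  have "sub_y p y = apply_y (\<lambda>h. peval h y) p"
    by (simp add: sub_y_eq apply_y_eq peval_mon)
  then show ?thesis
    by (simp add: apply_x_apply_y assms linear_peval)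
qed

section \<open>Jensen's inequality for sos-convex polynomials\<close>

text \<open>Growing polynomials by one variable at a time means that statements about derivatives
  need the product rule only for a variable as one factor.\<close>

lemma mpoly_induct [case_names one add scale var]:
  assumes one: "P 1"
    and add: "\<And>h k. P h \<Longrightarrow> P k \<Longrightarrow> P (h + k)"
    and scale: "\<And>c h. P h \<Longrightarrow> P (c *\<^sub>R h)"
    and var: "\<And>i h. P h \<Longrightarrow> P (var i * h)"
  shows "P (h :: 'v::finite mpoly)"
proof -
  have mon: "P (mon a)" for a :: "'v \<Rightarrow>\<^sub>0 nat"
  proof (induction "mon_deg a" arbitrary: a)
    case 0
    then have "a = 0"
      by (intro poly_mapping_eqI) (auto simp: mon_deg_def)
    then show ?case
      using one by simp
  next
    case (Suc n)
    then obtain i b where a: "a = Poly_Mapping.single i 1 + b"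
      by (metis mon_deg_Suc_split nat.distinct(1))
    then show ?case
      using Suc(1)[of b] Suc(2) var[of "mon b" i] by (simp add: var_def mon_add)
  qed
  have "P (\<Sum>a\<in>A. Poly_Mapping.lookup h a *\<^sub>R mon a)" if "finite A" for A
    using that
  proof (induction A rule: finite_induct)
    case empty
    then show ?case
      using scale[OF one, of 0] by simp
  qed (auto intro: add scale mon)
  from this[of "Poly_Mapping.keys h"] show ?thesis
    using lin_ext_mon_ident[of h] by (simp add: lin_ext_def)
qed

section \<open>Formal derivatives and rays\<close>

lemma linear_partial: "linear (partial i)"
  by (simp add: partial_eq linear_lin_ext)

lemma partial_mon:
  "partial i (mon a) = real (Poly_Mapping.lookup a i) *\<^sub>R mon (a - Poly_Mapping.single i 1)"
  by (simp add: partial_eq)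

lemma single_add_diff:
  "Poly_Mapping.lookup a i \<noteq> 0 \<Longrightarrow> Poly_Mapping.single i 1 + (a - Poly_Mapping.single i 1) = (a :: 'v \<Rightarrow>\<^sub>0 nat)"
  by (rule poly_mapping_eqI) (auto simp: lookup_add lookup_minus lookup_single when_def)

lemma partial_one: "partial i 1 = 0"
  using partial_mon[of i 0] by simp

lemma partial_var_mult: "partial i (var j * h) = (if i = j then h else 0) + var j * partial i h"
proof (rule linear_eqI_mon[of "\<lambda>h. partial i (var j * h)" "\<lambda>h. (if i = j then h else 0) + var j * partial i h"])
  show "linear (\<lambda>h. partial i (var j * h))" "linear (\<lambda>h. (if i = j then h else 0) + var j * partial i h)"
    by (intro linearI;
        simp add: ring_distribs linear_add[OF linear_partial] linear_scale[OF linear_partial] scaleR_add_right)+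
  fix a :: "'a \<Rightarrow>\<^sub>0 nat"
  let ?i = "Poly_Mapping.single i (1::nat)" and ?j = "Poly_Mapping.single j (1::nat)"
  have lhs: "partial i (var j * mon a) = real (Poly_Mapping.lookup (?j + a) i) *\<^sub>R mon (?j + a - ?i)"
    by (simp add: var_def partial_mon flip: mon_add)
  have rhs: "var j * partial i (mon a) = real (Poly_Mapping.lookup a i) *\<^sub>R mon (?j + (a - ?i))"
    by (simp add: var_def partial_mon mon_add)
  show "partial i (var j * mon a) = (if i = j then mon a else 0) + var j * partial i (mon a)"
  proof (cases "i = j")
    case True
    \<comment> \<open>If i does not occur in a, the truncated difference leaves a spurious factor,
      but then the coefficient is zero.\<close>
    have "real (Poly_Mapping.lookup a i) *\<^sub>R mon (?i + (a - ?i)) = real (Poly_Mapping.lookup a i) *\<^sub>R mon a"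
      using single_add_diff[of a i] by (cases "Poly_Mapping.lookup a i = 0") auto
    then show ?thesis
      using True unfolding lhs rhs by (auto simp: lookup_add scaleR_add_left)
  next
    case False
    have "?j + a - ?i = ?j + (a - ?i)"
      by (rule poly_mapping_eqI) (use False in \<open>auto simp: lookup_add lookup_minus lookup_single when_def\<close>)
    then show ?thesis
      using False unfolding lhs rhs by (simp add: lookup_add lookup_single when_def)
  qed
qed

lemma partial_in_polys_le:
  assumes "h \<in> polys_le (Suc k)"
  shows "partial i h \<in> polys_le k"
  unfolding partial_eq
proof (rule lin_ext_in_subspace[OF subspace_polys_le])
  fix a assume "a \<in> Poly_Mapping.keys h"
  then have "mon_deg a \<le> Suc k"
    using assms by (simp add: mem_polys_le)
  show "real (Poly_Mapping.lookup a i) *\<^sub>R mon (a - Poly_Mapping.single i 1) \<in> polys_le k"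
  proof (cases "Poly_Mapping.lookup a i = 0")
    case False
    then have "mon_deg a = Suc (mon_deg (a - Poly_Mapping.single i 1))"
      using arg_cong[OF single_add_diff[OF False], of mon_deg] by (simp del: One_nat_def)
    then show ?thesis
      using \<open>mon_deg a \<le> Suc k\<close> by (intro polys_le_closed) simp
  qed auto
qed

lemma partial_polys_le_0:
  assumes "h \<in> polys_le 0"
  shows "partial i h = 0"
proof -
  have "partial i h \<in> {0}"
    unfolding partial_eq
  proof (rule lin_ext_in_subspace[OF subspace_single_0])
    fix a assume "a \<in> Poly_Mapping.keys h"
    then have "Poly_Mapping.lookup a i = 0"
      using assms by (auto simp: mem_polys_le mon_deg_def)
    then show "real (Poly_Mapping.lookup a i) *\<^sub>R mon (a - Poly_Mapping.single i 1) \<in> {0}"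
      by simp
  qed
  then show ?thesis
    by simp
qed

text \<open>Here t is a number and x stays formal, so the result is again a polynomial in x of no
  larger degree, to which F can be applied for every t.\<close>

definition ray :: "real^'v::finite \<Rightarrow> real \<Rightarrow> 'v mpoly \<Rightarrow> 'v mpoly" where
  "ray u t = aeval (\<lambda>i. of_real (u $ i) + t *\<^sub>R (var i - of_real (u $ i)))"

lemma ray_in_polys_le: "h \<in> polys_le k \<Longrightarrow> ray u t h \<in> polys_le k"
  unfolding ray_def by (rule aeval_in_polys_le) (auto simp flip: const_eq_of_real)

lemma ray_0: "ray u 0 h = of_real (peval h u)"
  by (induction h rule: mpoly_induct) (simp_all add: ray_def peval_eq_aeval scaleR_conv_of_real[where 'a = real], simp add: scaleR_conv_of_real)

lemma ray_1: "ray u 1 h = h"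
  by (induction h rule: mpoly_induct) (simp_all add: ray_def)

text \<open>The chain rule under a linear functional. The induction must be over all F at once: for
  the product with \<open>var j\<close> it is used both for F and for the functional sending h to
  \<open>F ((var j - of_real (u $ j)) * h)\<close>.\<close>

lemma ray_has_derivative:
  assumes "linear F"
  shows "((\<lambda>t. F (ray u t h)) has_real_derivative
     F (\<Sum>i\<in>UNIV. (var i - of_real (u $ i)) * ray u t (partial i h))) (at t)"
  using assms
proof (induction h arbitrary: F rule: mpoly_induct)
  case one
  then show ?case
    by (simp add: ray_def partial_one linear_0)
next
  case (add h k)
  have "F (\<Sum>i\<in>UNIV. (var i - of_real (u $ i)) * ray u t (partial i (h + k)))
    = F (\<Sum>i\<in>UNIV. (var i - of_real (u $ i)) * ray u t (partial i h))
    + F (\<Sum>i\<in>UNIV. (var i - of_real (u $ i)) * ray u t (partial i k))"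
    by (simp add: ray_def linear_add[OF linear_partial] distrib_left sum.distrib linear_add[OF add.prems])
  moreover have "F (ray u t (h + k)) = F (ray u t h) + F (ray u t k)" for t
    by (simp add: ray_def linear_add[OF add.prems])
  ultimately show ?case
    using DERIV_add[OF add.IH(1)[OF add.prems] add.IH(2)[OF add.prems]] by simp
next
  case (scale c h)
  have "F (\<Sum>i\<in>UNIV. (var i - of_real (u $ i)) * ray u t (partial i (c *\<^sub>R h)))
    = c * F (\<Sum>i\<in>UNIV. (var i - of_real (u $ i)) * ray u t (partial i h))"
    by (simp add: ray_def linear_scale[OF linear_partial] linear_scale[OF scale.prems] flip: scaleR_sum_right)
  moreover have "F (ray u t (c *\<^sub>R h)) = c * F (ray u t h)" for t
    by (simp add: ray_def linear_scale[OF scale.prems])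
  ultimately show ?case
    using DERIV_cmult[OF scale.IH[OF scale.prems], of c] by simp
next
  case (var j h)
  let ?y = "\<lambda>i. var i - of_real (u $ i) :: 'a mpoly"
  let ?D = "\<Sum>i\<in>UNIV. ?y i * ray u t (partial i h)"
  have lin: "linear (\<lambda>h. F (?y j * h))"
    by (intro linearI) (simp_all add: distrib_left linear_add[OF var.prems] linear_scale[OF var.prems])
  have F_ray: "F (ray u t (var j * h)) = u $ j * F (ray u t h) + t * F (?y j * ray u t h)" for t
  proof -
    have "ray u t (var j * h) = (u $ j) *\<^sub>R ray u t h + t *\<^sub>R (?y j * ray u t h)"
      by (simp add: ray_def distrib_right scaleR_conv_of_real[of "u $ j"])
    then show ?thesis
      by (simp only: linear_add[OF var.prems] linear_scale[OF var.prems] real_scaleR_def)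
  qed
  have "(\<Sum>i\<in>UNIV. ?y i * ray u t (partial i (var j * h))) = ?y j * ray u t h + (u $ j) *\<^sub>R ?D + t *\<^sub>R (?y j * ?D)"
  proof -
    have "?y i * ray u t (partial i (var j * h)) =
      (if i = j then ?y j * ray u t h else 0) + ((u $ j) *\<^sub>R (?y i * ray u t (partial i h)) +
        t *\<^sub>R (?y j * (?y i * ray u t (partial i h))))" for i
    proof -
      have "a * (z + (of_real c + t *\<^sub>R b) * r) = a * z + (c *\<^sub>R (a * r) + t *\<^sub>R (b * (a * r)))"
        for a b z r :: "'a mpoly" and c
        by (simp add: algebra_simps scaleR_conv_of_real[of c])
      note this[of "?y i" "ray u t (if i = j then h else 0)" "u $ j" "?y j" "ray u t (partial i h)"]
      moreover have "ray u t (partial i (var j * h)) = ray u t (if i = j then h else 0)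
          + (of_real (u $ j) + t *\<^sub>R ?y j) * ray u t (partial i h)"
        by (simp add: partial_var_mult ray_def)
      moreover have "?y i * ray u t (if i = j then h else 0) = (if i = j then ?y j * ray u t h else 0)"
        by (simp add: ray_def)
      ultimately show ?thesis
        by simp
    qed
    then show ?thesis
      by (simp add: sum.distrib scaleR_sum_right sum_distrib_left)
  qed
  then have "F (\<Sum>i\<in>UNIV. ?y i * ray u t (partial i (var j * h)))
    = u $ j * F ?D + (F (?y j * ray u t h) + t * F (?y j * ?D))"
    by (simp only: linear_add[OF var.prems] linear_scale[OF var.prems] real_scaleR_def)
  then show ?case
    unfolding F_ray
    by (auto intro!: derivative_eq_intros var.IH[OF var.prems] var.IH[OF lin])
qed

text \<open>The two linear factors restore the degree lost by differentiating twice. For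
  \<open>D \<le> 1\<close> this count would go below zero, but there the second derivatives
  vanish.\<close>

lemma second_partial_in_polys_le:
  assumes "h \<in> polys_le D" "y \<in> polys_le 1" "z \<in> polys_le 1"
  shows "y * (z * ray u t (partial i (partial j h))) \<in> polys_le D"
proof (cases "D \<le> 1")
  case True
  then have "h \<in> polys_le (Suc 0)"
    using assms(1) by (auto intro: polys_le_mono)
  then have "partial i (partial j h) = 0"
    by (intro partial_polys_le_0 partial_in_polys_le)
  then show ?thesis
    by (simp add: ray_def)
next
  case False
  then obtain k where k: "D = 1 + (1 + k)"
    by (metis add.commute add_2_eq_Suc le_add_diff_inverse not_less_eq_eq numeral_2_eq_2 One_nat_def plus_1_eq_Suc)
  then have "ray u t (partial i (partial j h)) \<in> polys_le k"
    using assms(1) by (intro ray_in_polys_le partial_in_polys_le) simp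
  then show ?thesis
    unfolding k by (intro mult_in_polys_le assms)
qed

text \<open>
  Along the ray \<open>t \<mapsto> u + t (x - u)\<close> based at the mean \<open>u\<close> of \<open>F\<close>, the function \<open>t \<mapsto> F (h (u + t (x - u)))\<close>
  runs from \<open>h u\<close> to \<open>F h\<close>. It starts with slope zero, and its second derivative is \<open>F\<close> applied to
  a sum of squares, so it is convex. This avoids integrating the Hessian.
\<close>

lemma sos_convex_Jensen:
  assumes F: "linear F" "F 1 = 1"
    and pos: "\<And>\<sigma>. \<sigma> \<in> sos \<Longrightarrow> \<sigma> \<in> polys_le D \<Longrightarrow> 0 \<le> F \<sigma>"
    and h: "sos_convex h" "h \<in> polys_le D"
  shows "peval h (\<chi> i. F (var i)) \<le> F h"
proof -
  define u where "u = (\<chi> i. F (var i))"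
  \<comment> \<open>Centered coordinates, kept as polynomials; F vanishes on each of them.\<close>
  define y where "y i = var i - of_real (u $ i)" for i
  have y1: "y i \<in> polys_le 1" for i
    by (auto simp: y_def simp flip: const_eq_of_real)
  have F_y: "F (y i) = 0" for i
    by (simp add: y_def u_def linear_diff[OF F(1)] of_real_def linear_scale[OF F(1)] F(2))
  define f' where "f' t = F (\<Sum>i\<in>UNIV. y i * ray u t (partial i h))" for t
  define f'' where "f'' t = F (\<Sum>i\<in>UNIV. y i * (\<Sum>j\<in>UNIV. y j * ray u t (partial j (partial i h))))" for t
  have d1: "((\<lambda>t. F (ray u t h)) has_real_derivative f' t) (at t)" for t
    unfolding f'_def y_def by (rule ray_has_derivative[OF F(1)])
  have d2: "(f' has_real_derivative f'' t) (at t)" for t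
  proof -
    have lin: "linear (\<lambda>h. F (y i * h))" for i
      by (intro linearI) (simp_all add: distrib_left linear_add[OF F(1)] linear_scale[OF F(1)])
    show ?thesis
      unfolding f'_def f''_def linear_sum[OF F(1)]
      using ray_has_derivative[OF lin, where u = u, folded y_def] by (intro DERIV_sum)
  qed
  have "0 \<le> f'' t" for t
    unfolding f''_def
  proof (rule pos)
    \<comment> \<open>\<open>ray u t\<close> is a ring homomorphism, so the factorization H^T H of
      the Hessian persists along the ray, and the quadratic form in the \<open>y i\<close> is the
      sum of the squares of the entries of H y.\<close>
    obtain r :: nat and H where H: "\<And>i j. partial i (partial j h) = (\<Sum>l<r. H l i * H l j)"
      using h(1) unfolding sos_convex_def by blast
    have "y i * (\<Sum>j\<in>UNIV. y j * ray u t (partial j (partial i h)))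
      = (\<Sum>l<r. \<Sum>j\<in>UNIV. (y i * ray u t (H l i)) * (y j * ray u t (H l j)))" for i
      by (subst sum.swap) (simp add: H ray_def sum_distrib_left mult_ac)
    then have "(\<Sum>i\<in>UNIV. y i * (\<Sum>j\<in>UNIV. y j * ray u t (partial j (partial i h))))
      = (\<Sum>l<r. (\<Sum>i\<in>UNIV. y i * ray u t (H l i))\<^sup>2)"
      by (simp add: power2_eq_square sum_product) (rule sum.swap)
    then show "(\<Sum>i\<in>UNIV. y i * (\<Sum>j\<in>UNIV. y j * ray u t (partial j (partial i h)))) \<in> sos"
      by (auto simp: sos_def)
    show "(\<Sum>i\<in>UNIV. y i * (\<Sum>j\<in>UNIV. y j * ray u t (partial j (partial i h)))) \<in> polys_le D"
      unfolding sum_distrib_left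
      by (intro polys_le_closed second_partial_in_polys_le h y1)
  qed
  \<comment> \<open>A convex function lies above its tangent at 0; this is compared at t =
    1.\<close>
  then have "f' 0 * (1 - 0) \<le> F (ray u 1 h) - F (ray u 0 h)"
    by (intro f''_imp_f'[of UNIV _ f' f'']) (use d1 d2 in auto)
  \<comment> \<open>At t = 0 the gradient is the constant gradient at u, so F only meets multiples
    of the \<open>y i\<close>.\<close>
  moreover have "f' 0 = 0"
  proof -
    have "y i * ray u 0 (partial i h) = peval (partial i h) u *\<^sub>R y i" for i
      by (simp add: ray_0 scaleR_conv_of_real mult.commute)
    then show ?thesis
      by (simp add: f'_def linear_sum[OF F(1)] linear_scale[OF F(1)] F_y)
  qed
  moreover have "F (ray u 0 h) = peval h u"
    by (simp add: ray_0 of_real_def linear_scale[OF F(1)] F(2))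
  ultimately show ?thesis
    by (simp add: ray_1 u_def)
qed

section \<open>Positivity on the support of a measure\<close>

text \<open>The complement is a union of open null sets, and by Lindelof countably many of them
  cover it.\<close>

lemma emeasure_Compl_measure_support:
  fixes \<nu> :: "'a::second_countable_topology measure"
  assumes "sets \<nu> = sets borel"
  shows "- measure_support \<nu> \<in> null_sets \<nu>"
proof -
  define \<U> where "\<U> = {U. open U \<and> emeasure \<nu> U = 0}"
  have "- measure_support \<nu> = \<Union>\<U>"
    by (auto simp: measure_support_def \<U>_def not_less)
  moreover obtain \<V> where \<V>: "\<V> \<subseteq> \<U>" "countable \<V>" "\<Union>\<V> = \<Union>\<U>"
    using Lindelof[of \<U>] by (auto simp: \<U>_def)
  moreover have "(\<Union>U\<in>\<V>. U) \<in> null_sets \<nu>"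
    using \<V> assms by (intro null_sets_UN') (auto simp: \<U>_def null_sets_def)
  ultimately show ?thesis
    by simp
qed

context
  fixes \<nu> :: "'a::euclidean_space measure" and Y :: "'a set"
  assumes borel: "sets \<nu> = sets borel" and fin: "finite_measure \<nu>"
    and supp: "measure_support \<nu> = Y" and compact: "compact Y"
begin

interpretation finite_measure \<nu>
  by (rule fin)

lemma measure_ball_Int_support_pos:
  assumes "y \<in> Y" "0 < r"
  shows "0 < measure \<nu> (ball y r \<inter> Y)"
proof -
  have meas: "ball y r \<in> sets \<nu>" "Y \<in> sets \<nu>"
    using borel compact by (auto simp: compact_imp_closed)
  have "0 < emeasure \<nu> (ball y r)"
    using assms supp by (auto simp: measure_support_def)
  also have "emeasure \<nu> (ball y r) = emeasure \<nu> (ball y r \<inter> Y)"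
    using emeasure_Compl_measure_support[OF borel] meas supp
    by (intro emeasure_eq_AE AE_I') auto
  finally show ?thesis
    by (simp add: emeasure_eq_measure)
qed

lemma set_integrable_continuous:
  fixes f :: "'a \<Rightarrow> real"
  assumes "continuous_on UNIV f"
  shows "set_integrable \<nu> Y f"
proof -
  have "f \<in> borel_measurable \<nu>"
    using borel_measurable_continuous_onI[OF assms] measurable_cong_sets[OF borel refl] by blast
  moreover have "Y \<in> sets \<nu>"
    using borel compact by (auto simp: compact_imp_closed)
  moreover have "bounded (f ` Y)"
    using assms compact continuous_on_subset by (intro compact_imp_bounded compact_continuous_image) auto
  then obtain B where "\<And>y. y \<in> Y \<Longrightarrow> norm (f y) \<le> B"
    by (auto simp: bounded_iff)
  then have "AE y in \<nu>. norm (indicator Y y *\<^sub>R f y) \<le> max 0 B"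
    by (intro AE_I2) (auto simp: indicator_def intro: max.coboundedI2)
  ultimately show ?thesis
    unfolding set_integrable_def by (intro integrable_const_bound) auto
qed

text \<open>
  The weight \<open>(c - |y - z|\<^sup>2)\<^sup>2\<^sup>N\<close> is, for large \<open>N\<close>, exponentially larger on the ball of radius
  \<open>\<delta> / 2\<close> around \<open>z\<close> than outside the ball of radius \<open>\<delta>\<close>, so it isolates the sign of \<open>\<psi> z\<close>.
\<close>

lemma nonneg_on_support:
  fixes \<psi> :: "'a \<Rightarrow> real"
  assumes cont: "continuous_on UNIV \<psi>" and z: "z \<in> Y"
    and int: "\<And>c N. 0 \<le> (LINT y:Y|\<nu>. \<psi> y * (c - (norm (y - z))\<^sup>2) ^ (2 * N))"
  shows "0 \<le> \<psi> z"
proof (rule ccontr)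
  assume "\<not> 0 \<le> \<psi> z"
  \<comment> \<open>Half the gap, so that continuity leaves \<open>\<psi> \<le> - e\<close> near
    z.\<close>
  define e where "e = - \<psi> z / 2"
  have "0 < e"
    using \<open>\<not> 0 \<le> \<psi> z\<close> by (simp add: e_def)
  obtain \<delta> where "0 < \<delta>" and \<delta>: "\<And>y. dist y z < \<delta> \<Longrightarrow> dist (\<psi> y) (\<psi> z) < e"
    using cont \<open>0 < e\<close> unfolding continuous_on_iff by (metis UNIV_I)
  have near: "\<psi> y \<le> - e" if "dist y z < \<delta>" for y
    using \<delta>[OF that] by (auto simp: dist_real_def e_def)
  obtain E where E: "\<And>y. y \<in> Y \<Longrightarrow> norm (y - z) \<le> E"
    using compact_imp_bounded[OF compact] bounded_any_center[of Y z] by (auto simp: dist_norm norm_minus_commute)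
  have "bounded (\<psi> ` Y)"
    using cont compact continuous_on_subset by (intro compact_imp_bounded compact_continuous_image) auto
  then obtain C where C: "\<And>y. y \<in> Y \<Longrightarrow> \<bar>\<psi> y\<bar> \<le> C"
    by (auto simp: bounded_iff)
  \<comment> \<open>E bounds the distance from z on Y, hence the weight \<open>w\<close> is positive
    on Y and \<open>\<beta>\<close> equals E^2 + 1.\<close>
  define c where "c = E\<^sup>2 + \<delta>\<^sup>2 + 1"
  define w where "w y = c - (norm (y - z))\<^sup>2" for y
  define \<alpha> where "\<alpha> = c - (\<delta> / 2)\<^sup>2"
  define \<beta> where "\<beta> = c - \<delta>\<^sup>2"
  have "(\<delta> / 2)\<^sup>2 < \<delta>\<^sup>2"
    using \<open>0 < \<delta>\<close> by (simp add: power2_eq_square)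
  then have \<alpha>\<beta>: "0 < \<beta>" "\<beta> < \<alpha>"
    by (simp_all add: \<alpha>_def \<beta>_def c_def add_nonneg_pos)
  have w_nonneg: "0 \<le> w y" if "y \<in> Y" for y
    using power_mono[OF E[OF that] norm_ge_zero, of 2] zero_le_power2[of \<delta>] unfolding w_def c_def by linarith
  let ?B = "ball z (\<delta> / 2) \<inter> Y"
  have bound: "\<psi> y * w y ^ (2 * N) \<le> C * \<beta> ^ (2 * N) - e * \<alpha> ^ (2 * N) * indicator ?B y"
    if "y \<in> Y" for y N
  proof -
    have "0 \<le> C"
      using C[OF that] by linarith
    consider "y \<in> ?B" | "y \<notin> ?B" "dist y z < \<delta>" | "\<delta> \<le> dist y z"
      by linarith
    then show ?thesis
    proof cases
      case 1
      then have "norm (y - z) \<le> \<delta> / 2" "dist y z < \<delta>"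
        using \<open>0 < \<delta>\<close> by (auto simp: dist_norm norm_minus_commute)
      then have "\<alpha> \<le> w y" "\<psi> y \<le> - e"
        using near power_mono[of "norm (y - z)" "\<delta> / 2" 2] by (auto simp: \<alpha>_def w_def)
      then have "e * \<alpha> ^ (2 * N) \<le> (- \<psi> y) * w y ^ (2 * N)"
        using \<alpha>\<beta> \<open>0 < e\<close> by (intro mult_mono power_mono) auto
      moreover have "0 \<le> C * \<beta> ^ (2 * N)"
        using \<open>0 \<le> C\<close> \<alpha>\<beta> by simp
      ultimately show ?thesis
        using 1 by simp
    next
      \<comment> \<open>In the shell around the small ball only the sign of \<psi> is used: the
        integrand is at most 0.\<close>
      case 2
      then have "\<psi> y * w y ^ (2 * N) \<le> 0"
        using near[of y] \<open>0 < e\<close> w_nonneg[OF that] by (intro mult_nonpos_nonneg) auto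
      also have "0 \<le> C * \<beta> ^ (2 * N)"
        using \<open>0 \<le> C\<close> \<alpha>\<beta> by simp
      finally show ?thesis
        using 2 by simp
    next
      case 3
      then have "\<delta> \<le> norm (y - z)"
        by (simp add: dist_norm)
      then have "w y \<le> \<beta>"
        using power_mono[of \<delta> "norm (y - z)" 2] \<open>0 < \<delta>\<close> by (auto simp: \<beta>_def w_def)
      moreover have "\<psi> y \<le> C"
        using C[OF that] by linarith
      ultimately have "\<psi> y * w y ^ (2 * N) \<le> C * \<beta> ^ (2 * N)"
        using w_nonneg[OF that] \<open>0 \<le> C\<close> by (intro mult_mono power_mono) auto
      moreover have "y \<notin> ?B"
        using 3 \<open>0 < \<delta>\<close> by (auto simp: dist_commute)
      ultimately show ?thesis
        by simp
    qed
  qed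
  have meas: "?B \<in> sets \<nu>" "Y \<in> sets \<nu>"
    using borel compact by (auto simp: compact_imp_closed)
  \<comment> \<open>\<open>bound\<close> is integrated and divided by
    \<open>\<alpha> ^ (2 * N)\<close>. The right side tends to 0 while the left side is a fixed
    positive number.\<close>
  have le: "e * measure \<nu> ?B \<le> C * measure \<nu> Y * ((\<beta> / \<alpha>)\<^sup>2) ^ N" for N
  proof -
    have int_const: "set_integrable \<nu> Y (\<lambda>y. k)" for k :: real
      by (rule set_integrable_continuous) auto
    have int_ind: "set_integrable \<nu> Y (\<lambda>y. k * indicator ?B y)" for k :: real
    proof -
      have "(\<lambda>y. indicator Y y *\<^sub>R (k * indicator ?B y)) = (\<lambda>y. k * indicator ?B y)"
        by (auto simp: indicator_def)
      then show ?thesis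
        unfolding set_integrable_def using meas
        by (simp add: integrable_real_indicator less_top[symmetric])
    qed
    have "0 \<le> (LINT y:Y|\<nu>. \<psi> y * w y ^ (2 * N))"
      unfolding w_def by (rule int)
    also have "\<dots> \<le> (LINT y:Y|\<nu>. C * \<beta> ^ (2 * N) - e * \<alpha> ^ (2 * N) * indicator ?B y)"
    proof (rule set_integral_mono)
      show "set_integrable \<nu> Y (\<lambda>y. \<psi> y * w y ^ (2 * N))"
        unfolding w_def by (intro set_integrable_continuous continuous_intros cont)
      show "set_integrable \<nu> Y (\<lambda>y. C * \<beta> ^ (2 * N) - e * \<alpha> ^ (2 * N) * indicator ?B y)"
        by (intro set_integral_diff(1) int_const int_ind)
    qed (rule bound)
    also have "\<dots> = (LINT y:Y|\<nu>. C * \<beta> ^ (2 * N)) - (LINT y:Y|\<nu>. e * \<alpha> ^ (2 * N) * indicator ?B y)"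
      by (intro set_integral_diff(2) int_const int_ind)
    also have "(LINT y:Y|\<nu>. e * \<alpha> ^ (2 * N) * indicator ?B y) = (LINT y|\<nu>. indicator ?B y * (e * \<alpha> ^ (2 * N)))"
      unfolding set_lebesgue_integral_def by (intro Bochner_Integration.integral_cong) (auto simp: indicator_def)
    also have "\<dots> = measure \<nu> ?B * (e * \<alpha> ^ (2 * N))"
      using meas by simp
    also have "(LINT y:Y|\<nu>. C * \<beta> ^ (2 * N)) = measure \<nu> Y * (C * \<beta> ^ (2 * N))"
      unfolding set_lebesgue_integral_def using meas by simp
    finally show ?thesis
      using \<alpha>\<beta> unfolding power_mult power_divide by (simp add: field_simps)
  qed
  have "(\<lambda>N. C * measure \<nu> Y * ((\<beta> / \<alpha>)\<^sup>2) ^ N) \<longlonglongrightarrow> C * measure \<nu> Y * 0"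
    using \<alpha>\<beta> by (intro tendsto_intros LIMSEQ_realpow_zero) (auto simp: power_less_one_iff abs_square_less_1)
  then have "e * measure \<nu> ?B \<le> C * measure \<nu> Y * 0"
    by (rule LIMSEQ_le_const) (use le in auto)
  moreover have "0 < measure \<nu> ?B"
    using z \<open>0 < \<delta>\<close> by (intro measure_ball_Int_support_pos) auto
  ultimately show False
    using \<open>0 < e\<close> by (simp add: mult_le_0_iff)
qed

end

section \<open>Moment functionals and the cones \<open>P_cone\<close>\<close>

lemma continuous_peval [continuous_intros]: "continuous_on A (peval h)"
proof -
  have "continuous_on A (\<lambda>x. \<Sum>a\<in>Poly_Mapping.keys h.
      Poly_Mapping.lookup h a * (\<Prod>i\<in>UNIV. (x $ i) ^ Poly_Mapping.lookup a i))"
    by (intro continuous_intros)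
  then show ?thesis
    by (simp add: peval_def[abs_def] mon_eval_def)
qed

text \<open>The weight comes first, so that \<open>moment \<nu> Y \<sigma>\<close> is a functional
  that \<open>apply_y\<close> accepts.\<close>

definition moment :: "(real^'n) measure \<Rightarrow> (real^'n) set \<Rightarrow> 'n::finite mpoly \<Rightarrow> 'n mpoly \<Rightarrow> real" where
  "moment \<nu> Y \<sigma> \<psi> = (LINT y:Y|\<nu>. peval \<psi> y * peval \<sigma> y)"

lemma mem_P_cone:
  "\<psi> \<in> P_cone d \<nu> Y k \<longleftrightarrow> \<psi> \<in> polys_le d \<and> (\<forall>\<sigma>\<in>sos \<inter> polys_le (2 * k). 0 \<le> moment \<nu> Y \<sigma> \<psi>)"
  by (simp add: P_cone_def moment_def)

context
  fixes \<nu> :: "(real^'n::finite) measure" and Y :: "(real^'n) set"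
  assumes borel: "sets \<nu> = sets borel" and fin: "finite_measure \<nu>"
    and supp: "measure_support \<nu> = Y" and compact: "compact Y"
begin

lemma linear_moment: "linear (moment \<nu> Y \<sigma>)"
proof
  have int: "set_integrable \<nu> Y (\<lambda>y. peval \<psi> y * peval \<sigma> y)" for \<psi>
    by (intro set_integrable_continuous[OF borel fin supp compact] continuous_intros)
  show "moment \<nu> Y \<sigma> (h + k) = moment \<nu> Y \<sigma> h + moment \<nu> Y \<sigma> k" for h k
    using set_integral_add(2)[OF int int] by (simp add: moment_def linear_add[OF linear_peval] distrib_right)
  show "moment \<nu> Y \<sigma> (c *\<^sub>R h) = c *\<^sub>R moment \<nu> Y \<sigma> h" for c h
    by (simp add: moment_def linear_scale[OF linear_peval] mult.assoc)
qed

lemma nonneg_in_P_cone: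
  assumes "\<psi> \<in> polys_le d" "\<And>y. y \<in> Y \<Longrightarrow> 0 \<le> peval \<psi> y"
  shows "\<psi> \<in> P_cone d \<nu> Y k"
proof -
  have "0 \<le> moment \<nu> Y \<sigma> \<psi>" if "\<sigma> \<in> sos" for \<sigma>
    unfolding moment_def set_lebesgue_integral_def
  proof (rule Bochner_Integration.integral_nonneg)
    show "0 \<le> indicator Y y *\<^sub>R (peval \<psi> y * peval \<sigma> y)" for y
      using assms(2) peval_sos_nonneg[OF that] by (cases "y \<in> Y") auto
  qed
  then show ?thesis
    using assms(1) by (simp add: mem_P_cone)
qed

text \<open>The weights in \<open>nonneg_on_support\<close> are squares of polynomials, hence each
  of them is tested at some level k.\<close>

lemma P_cone_Inter_nonneg:
  assumes "\<And>k. \<psi> \<in> P_cone d \<nu> Y k" "z \<in> Y"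
  shows "0 \<le> peval \<psi> z"
proof (rule nonneg_on_support[OF borel fin supp compact _ assms(2)])
  show "continuous_on UNIV (peval \<psi>)"
    by (rule continuous_peval)
  fix c and N :: nat
  define \<omega> :: "'n mpoly" where "\<omega> = of_real c - (\<Sum>i\<in>UNIV. (var i - of_real (z $ i))\<^sup>2)"
  have "peval \<omega> y = c - (norm (y - z))\<^sup>2" for y
    by (simp add: \<omega>_def peval_eq_aeval norm_vec_def L2_set_def sum_nonneg)
  then have "peval ((\<omega> ^ N)\<^sup>2) y = (c - (norm (y - z))\<^sup>2) ^ (2 * N)" for y
    by (simp add: peval_eq_aeval power_mult[symmetric] mult.commute)
  moreover have "0 \<le> moment \<nu> Y ((\<omega> ^ N)\<^sup>2) \<psi>"
    \<comment> \<open>Level k admits weights up to degree 2k, so the degree of the weight is itself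
      a sufficient level.\<close>
    using assms(1)[of "pdeg ((\<omega> ^ N)\<^sup>2)"] by (auto simp: mem_P_cone polys_le_def)
  ultimately show "0 \<le> (LINT y:Y|\<nu>. peval \<psi> y * (c - (norm (y - z))\<^sup>2) ^ (2 * N))"
    by (simp add: moment_def)
qed

end

lemma P_cone_antimono:
  assumes "j \<le> k"
  shows "P_cone d \<nu> Y k \<subseteq> P_cone d \<nu> Y j"
proof -
  have "\<sigma> \<in> polys_le (2 * k)" if "\<sigma> \<in> polys_le (2 * j)" for \<sigma> :: "'a mpoly"
    using that assms by (auto intro: polys_le_mono)
  then show ?thesis
    unfolding P_cone_def by blast
qed

section \<open>The relaxations\<close>

lemma linear_zero_fun: "linear (\<lambda>x. 0)"
  by (intro linearI) auto

lemma apply_y_add: "apply_y (\<lambda>h. H h + H' h) p = apply_y H p + apply_y H' p"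
  by (simp add: apply_y_eq lin_ext_def case_prod_beta scaleR_add_left scaleR_add_right sum.distrib)

lemma apply_y_scale: "apply_y (\<lambda>h. c * H h) p = c *\<^sub>R apply_y H p"
  by (simp add: apply_y_eq lin_ext_def case_prod_beta scaleR_sum_right mult.left_commute)

lemma pdeg_le_half_deg:
  assumes "n \<in> {pdeg f, pdeg g, pdeg_x p} \<union> (\<lambda>j. pdeg (\<phi> j)) ` {1..s}"
  shows "n \<le> 2 * half_deg f g s \<phi> p"
proof -
  let ?M = "Max ({pdeg f, pdeg g, pdeg_x p} \<union> (\<lambda>j. pdeg (\<phi> j)) ` {1..s})"
  have "n \<le> ?M"
    by (rule Max_ge) (use assms in auto)
  moreover have "real ?M / 2 \<le> real (half_deg f g s \<phi> p)"
    unfolding half_deg_def by (rule real_nat_ceiling_ge)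
  ultimately show ?thesis
    by linarith
qed

context
  fixes f g :: "'m::finite mpoly"
    and s :: nat
    and \<phi> :: "nat \<Rightarrow> 'm mpoly"
    and p :: "('m, 'n::finite) mpoly2"
    and Y :: "(real^'n) set"
    and \<nu> :: "(real^'n) measure"
    and R gs :: real
  assumes d_pos: "half_deg f g s \<phi> p \<ge> 1"
    and borel: "sets \<nu> = sets borel"
    and fin: "finite_measure \<nu>"
    and supp: "measure_support \<nu> = Y"
    and compact: "compact Y"
    and gs_pos: "gs > 0"
    and opt: "\<exists>u\<in>optimal_set f g s \<phi> p Y. norm u \<le> R \<and> peval g u \<ge> gs"
    and convex: "\<forall>j\<in>{1..s}. sos_convex (\<phi> j)" "\<forall>y\<in>Y. sos_convex (sub_y p y)"
      "sos_convex f" "sos_convex (- g)"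
    and num_den: "(\<forall>x\<in>feasible_set s \<phi> p Y. peval f x \<ge> 0 \<and> peval g x > 0) \<or>
      (pdeg g \<le> 1 \<and> (\<forall>x\<in>feasible_set s \<phi> p Y. peval g x > 0))"
begin

section \<open>Feasible functionals: bounds and compactness\<close>

abbreviation (input) "D \<equiv> 2 * half_deg f g s \<phi> p"
abbreviation (input) "M \<equiv> M_cone (half_deg f g s \<phi> p) R g gs"
abbreviation (input) "P k \<equiv> P_cone (pdeg_y p) \<nu> Y k"

definition dual_functional :: "nat \<Rightarrow> ('m mpoly \<Rightarrow> real) \<Rightarrow> bool" where
  "dual_functional k F \<longleftrightarrow> linear F \<and> (\<forall>h\<in>M. 0 \<le> F h) \<and> F g = 1 \<and>
     - apply_x F p \<in> P k \<and> (\<forall>j\<in>{1..s}. F (\<phi> j) \<le> 0)"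

lemma data_in_polys_le:
  "f \<in> polys_le D" "g \<in> polys_le D" "j \<in> {1..s} \<Longrightarrow> \<phi> j \<in> polys_le D" "var i \<in> polys_le D"
  "pdeg_x p \<le> D"
proof -
  show "var i \<in> polys_le D"
    using d_pos by simp
  show "pdeg_x p \<le> D"
    by (rule pdeg_le_half_deg) simp
  show "f \<in> polys_le D" "g \<in> polys_le D" "j \<in> {1..s} \<Longrightarrow> \<phi> j \<in> polys_le D"
    unfolding polys_le_def by (auto intro!: pdeg_le_half_deg)
qed

lemma M_in_polys_le: "h \<in> M \<Longrightarrow> h \<in> polys_le D"
  using M_cone_subset_polys_le by blast

lemma apply_y_in_polys_le': "apply_y H p \<in> polys_le D"
  using apply_y_in_polys_le data_in_polys_le(5) by (rule polys_le_mono)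

text \<open>The constraints test only polynomials of degree at most \<open>D\<close>, so total maps
  describe the same feasible set.\<close>

lemma dual_feasible_eq:
  "dual_feasible f g s \<phi> p Y \<nu> R gs k = (\<lambda>F. restrict F (polys_le D)) ` {F. dual_functional k F}"
proof (intro set_eqI iffI)
  fix L assume L: "L \<in> dual_feasible f g s \<phi> p Y \<nu> R gs k"
  then have LD: "L \<in> dual_space (polys_le D)"
    by (auto simp: dual_feasible_def dual_cone_def)
  obtain F where F: "linear F" "\<And>h. h \<in> polys_le D \<Longrightarrow> F h = L h"
    using dual_space_linear_ext[OF LD] by blast
  have "dual_functional k F"
    unfolding dual_functional_def
    using L F M_in_polys_le data_in_polys_le
      apply_x_cong[OF data_in_polys_le(5) F(2)]
    by (auto simp: dual_feasible_def dual_cone_def)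
  moreover have "L = restrict F (polys_le D)"
    using LD F(2) by (auto simp: dual_space_def extensional_def restrict_def fun_eq_iff)
  ultimately show "L \<in> (\<lambda>F. restrict F (polys_le D)) ` {F. dual_functional k F}"
    by blast
next
  fix L assume "L \<in> (\<lambda>F. restrict F (polys_le D)) ` {F. dual_functional k F}"
  then obtain F where F: "dual_functional k F" "L = restrict F (polys_le D)"
    by blast
  have "apply_x F p = apply_x L p"
    using data_in_polys_le(5) by (rule apply_x_cong) (simp add: F(2))
  then show "L \<in> dual_feasible f g s \<phi> p Y \<nu> R gs k"
    using F M_in_polys_le data_in_polys_le
    by (auto simp: dual_feasible_def dual_cone_def dual_functional_def restrict_linear_in_dual_space)
qed

text \<open>Turns membership of a polynomial in y into scalar inequalities that are linear in F, the
  form needed for limits and for duality.\<close>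

lemma P_cone_eq: "- apply_x F p \<in> P k \<longleftrightarrow> (\<forall>\<sigma>\<in>sos \<inter> polys_le (2 * k). F (apply_y (moment \<nu> Y \<sigma>) p) \<le> 0)"
  if "linear F"
proof -
  have "moment \<nu> Y \<sigma> (- apply_x F p) = - F (apply_y (moment \<nu> Y \<sigma>) p)" for \<sigma>
    using linear_moment[OF borel fin supp compact] that
    by (simp add: apply_x_apply_y linear_neg)
  then show ?thesis
    by (auto simp: mem_P_cone apply_x_in_polys_le)
qed

lemma dual_functional_antimono: "j \<le> k \<Longrightarrow> dual_functional k F \<Longrightarrow> dual_functional j F"
  using P_cone_antimono[of j k "pdeg_y p" \<nu> Y] by (auto simp: dual_functional_def)

lemma one_in_M: "1 \<in> M"
  using sos_square[of 1] by (intro sos_in_M_cone) auto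

lemma zero_in_M: "0 \<in> M"
  by (intro sos_in_M_cone) auto

text \<open>The order unit property for \<open>h\<close> and \<open>- h\<close>; the constant
  depends on \<open>h\<close> only, not on the functional.\<close>

lemma functional_bounded_by_one:
  assumes "h \<in> polys_le D"
  shows "\<exists>C. \<forall>F :: 'm mpoly \<Rightarrow> real. linear F \<longrightarrow> (\<forall>h\<in>M. 0 \<le> F h) \<longrightarrow> \<bar>F h\<bar> \<le> C * F 1"
proof -
  obtain t t' where t: "of_real t + h \<in> M" "of_real t' + - h \<in> M"
    using M_cone_order_unit assms polys_le_closed(3) by metis
  have "\<bar>F h\<bar> \<le> max t t' * F 1" if F: "linear F" "\<forall>h\<in>M. 0 \<le> F h" for F :: "'m mpoly \<Rightarrow> real"
  proof -
    have "0 \<le> t * F 1 + F h" "0 \<le> t' * F 1 - F h"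
      using bspec[OF F(2) t(1)] bspec[OF F(2) t(2)]
      by (simp_all add: of_real_def linear_add[OF F(1)] linear_diff[OF F(1)] linear_neg[OF F(1)] linear_scale[OF F(1)])
    moreover have "t * F 1 \<le> max t t' * F 1" "t' * F 1 \<le> max t t' * F 1"
      using bspec[OF F(2) one_in_M] by (auto intro: mult_right_mono)
    ultimately show ?thesis
      by linarith
  qed
  then show ?thesis
    by blast
qed

lemma functional_g_ge:
  fixes F :: "'m mpoly \<Rightarrow> real"
  assumes "linear F" "\<forall>h\<in>M. 0 \<le> F h"
  shows "gs * F 1 \<le> F g"
  using bspec[OF assms(2) q2_in_M_cone[OF data_in_polys_le(2)]]
  by (simp add: q2_def const_eq_of_real of_real_def linear_diff[OF assms(1)] linear_scale[OF assms(1)])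

lemma dual_functional_one:
  assumes "dual_functional k F"
  shows "0 < F 1" "F 1 \<le> 1 / gs"
proof -
  have F: "linear F" "\<forall>h\<in>M. 0 \<le> F h" "F g = 1"
    using assms by (auto simp: dual_functional_def)
  show "F 1 \<le> 1 / gs"
    using functional_g_ge[OF F(1,2)] F(3) gs_pos by (simp add: field_simps)
  \<comment> \<open>If \<open>F 1\<close> were 0, this bound would force \<open>F g = 0\<close>,
    against the normalization.\<close>
  obtain C where "\<bar>F g\<bar> \<le> C * F 1"
    using functional_bounded_by_one[OF data_in_polys_le(2)] F by blast
  then have "F 1 \<noteq> 0"
    using F(3) by auto
  then show "0 < F 1"
    using bspec[OF F(2) one_in_M] by simp
qed

lemma dual_functional_bounded:
  assumes "h \<in> polys_le D"
  shows "\<exists>C. \<forall>k F. dual_functional k F \<longrightarrow> \<bar>F h\<bar> \<le> C"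
proof -
  obtain C where C: "\<And>F :: 'm mpoly \<Rightarrow> real. linear F \<Longrightarrow> \<forall>h\<in>M. 0 \<le> F h \<Longrightarrow> \<bar>F h\<bar> \<le> C * F 1"
    using functional_bounded_by_one[OF assms] by blast
  \<comment> \<open>C may be negative, and \<open>F 1\<close> is about to be replaced by the larger
    \<open>1 / gs\<close>.\<close>
  have "\<bar>F h\<bar> \<le> max 0 C * (1 / gs)" if F: "dual_functional k F" for k F
  proof -
    have "\<bar>F h\<bar> \<le> C * F 1"
      using F C by (auto simp: dual_functional_def)
    also have "\<dots> \<le> max 0 C * (1 / gs)"
      using dual_functional_one[OF F] by (intro mult_mono) auto
    finally show ?thesis .
  qed
  then show ?thesis
    by blast
qed

text \<open>The levels may vary along the sequence: constant \<kappa> serves attainment, increasing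
  \<kappa> the limit of the hierarchy. Since higher levels have fewer feasible functionals, the
  limit inherits each level that is eventually reached.\<close>

lemma dual_functional_compact:
  fixes \<kappa> :: "nat \<Rightarrow> nat"
  assumes F: "\<And>n. dual_functional (\<kappa> n) (F n)"
  shows "\<exists>r G. strict_mono r \<and> (\<forall>h\<in>polys_le D. (\<lambda>n. F (r n) h) \<longlonglongrightarrow> G h) \<and>
     (\<forall>k. (\<forall>\<^sub>F n in sequentially. k \<le> \<kappa> n) \<longrightarrow> dual_functional k G)"
proof -
  let ?T = "{a. mon_deg a \<le> D}"
  have linF: "linear (F n)" for n
    using F by (simp add: dual_functional_def)
  have "\<exists>C. \<forall>n. \<bar>F n (mon a)\<bar> \<le> C" if "a \<in> ?T" for a
    using dual_functional_bounded[of "mon a"] that F by fastforce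
  then obtain C where "\<And>a n. a \<in> ?T \<Longrightarrow> \<bar>F n (mon a)\<bar> \<le> C a"
    by metis
  from pointwise_bounded_subsequence[of ?T "\<lambda>n a. F n (mon a)", OF finite_mon_deg_le this]
  obtain r l where r: "strict_mono r" and l: "\<And>a. a \<in> ?T \<Longrightarrow> (\<lambda>n. F (r n) (mon a)) \<longlonglongrightarrow> l a"
    by blast
  \<comment> \<open>\<open>l\<close> is arbitrary above degree \<open>D\<close>; convergence is
    claimed only up to that degree.\<close>
  define G where "G = lin_ext l"
  have linG: "linear G"
    by (simp add: G_def linear_lin_ext)
  have lim: "(\<lambda>n. F (r n) h) \<longlonglongrightarrow> G h" if "h \<in> polys_le D" for h
    unfolding G_def linear_expand[OF linF, of _ h] lin_ext_def mon_def[symmetric]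
    using that by (intro tendsto_intros l) (auto simp: mem_polys_le)
  have "dual_functional k G" if k: "\<forall>\<^sub>F n in sequentially. k \<le> \<kappa> n" for k
  proof -
    have ev: "\<forall>\<^sub>F n in sequentially. dual_functional k (F (r n))"
      using eventually_subseq[OF r k] by eventually_elim (use F dual_functional_antimono in blast)
    have nonneg: "0 \<le> G h" if "h \<in> polys_le D" "\<And>F. dual_functional k F \<Longrightarrow> 0 \<le> F h" for h
      using lim[OF that(1)] by (rule tendsto_lowerbound) (use ev that(2) in \<open>auto elim: eventually_mono\<close>)
    have nonpos: "G h \<le> 0" if "h \<in> polys_le D" "\<And>F. dual_functional k F \<Longrightarrow> F h \<le> 0" for h
      using lim[OF that(1)] by (rule tendsto_upperbound) (use ev that(2) in \<open>auto elim: eventually_mono\<close>)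
    have "(\<lambda>n. F (r n) g) \<longlonglongrightarrow> 1"
      using F by (simp add: dual_functional_def)
    then have "G g = 1"
      using lim[OF data_in_polys_le(2)] LIMSEQ_unique by blast
    moreover have "\<forall>h\<in>M. 0 \<le> G h"
      by (auto intro!: nonneg M_in_polys_le simp: dual_functional_def)
    moreover have "\<forall>j\<in>{1..s}. G (\<phi> j) \<le> 0"
      using data_in_polys_le(3) by (auto intro!: nonpos simp: dual_functional_def)
    moreover have "- apply_x G p \<in> P k"
      unfolding P_cone_eq[OF linG]
    proof
      fix \<sigma> :: "'n mpoly" assume "\<sigma> \<in> sos \<inter> polys_le (2 * k)"
      then show "G (apply_y (moment \<nu> Y \<sigma>) p) \<le> 0"
        using P_cone_eq by (intro nonpos apply_y_in_polys_le') (auto simp: dual_functional_def)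
    qed
    ultimately show ?thesis
      using linG by (simp add: dual_functional_def)
  qed
  then show ?thesis
    using r lim by blast
qed

text \<open>All optimal points share one quotient, so the choice is immaterial.\<close>

definition opt_value :: real where
  "opt_value = (SOME v. \<exists>u\<in>optimal_set f g s \<phi> p Y. v = peval f u / peval g u)"

lemma opt_value_eq:
  assumes "u \<in> optimal_set f g s \<phi> p Y"
  shows "peval f u / peval g u = opt_value"
proof -
  have "\<exists>v. \<exists>u\<in>optimal_set f g s \<phi> p Y. v = peval f u / peval g u"
    using assms by blast
  from someI_ex[OF this] obtain w where
    "w \<in> optimal_set f g s \<phi> p Y" "opt_value = peval f w / peval g w"
    unfolding opt_value_def by blast
  then show ?thesis
    using assms by (force simp: optimal_set_def)
qed

lemma optimal_if_le:
  assumes "u \<in> feasible_set s \<phi> p Y" "peval f u / peval g u \<le> opt_value"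
  shows "u \<in> optimal_set f g s \<phi> p Y"
proof -
  obtain w where "w \<in> optimal_set f g s \<phi> p Y"
    using opt by blast
  with opt_value_eq[OF this] show ?thesis
    using assms by (force simp: optimal_set_def)
qed

lemma opt_value_le:
  assumes "u \<in> feasible_set s \<phi> p Y"
  shows "opt_value \<le> peval f u / peval g u"
proof -
  obtain w where "w \<in> optimal_set f g s \<phi> p Y"
    using opt by blast
  with opt_value_eq[OF this] show ?thesis
    using assms by (force simp: optimal_set_def)
qed

lemma r_star_eq: "r_star f g s \<phi> p Y = ereal opt_value"
proof -
  obtain w where w: "w \<in> optimal_set f g s \<phi> p Y"
    using opt by blast
  then show ?thesis
    unfolding r_star_def
    using opt_value_eq[OF w] opt_value_le
    by (intro antisym INF_lower2[of w] INF_greatest) (auto simp: optimal_set_def)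
qed

text \<open>Evaluation at the prescribed optimal point, divided by the value of \<open>g\<close>
  there to meet the normalization.\<close>

lemma evaluation_dual_functional: "\<exists>F. dual_functional k F \<and> F f = opt_value"
proof -
  obtain u where u: "u \<in> optimal_set f g s \<phi> p Y" "norm u \<le> R" "peval g u \<ge> gs"
    using opt by blast
  define F where "F h = peval h u / peval g u" for h
  have g: "0 < peval g u"
    using u(3) gs_pos by linarith
  have K: "u \<in> feasible_set s \<phi> p Y"
    using u(1) by (simp add: optimal_set_def)
  have lin: "linear F"
    unfolding F_def
    by (intro linearI) (simp_all add: linear_add[OF linear_peval] linear_scale[OF linear_peval] add_divide_distrib)
  have "0 \<le> peval (- apply_x F p) y" if "y \<in> Y" for y
  proof -
    have "peval (- apply_x F p) y = - F (sub_y p y)"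
      by (simp add: linear_neg[OF linear_peval] linear_sub_y[OF lin])
    then show ?thesis
      using K that g by (simp add: feasible_set_def F_def divide_nonpos_pos)
  qed
  then have "- apply_x F p \<in> P k"
    by (intro nonneg_in_P_cone[OF borel fin supp compact] polys_le_closed apply_x_in_polys_le)
  moreover have "\<forall>h\<in>M. 0 \<le> F h"
    using peval_M_cone_nonneg[OF _ u(2,3)] g by (simp add: F_def)
  moreover have "\<forall>j\<in>{1..s}. F (\<phi> j) \<le> 0"
    using K g by (simp add: feasible_set_def F_def divide_nonpos_pos)
  ultimately have "dual_functional k F"
    using lin g by (simp add: dual_functional_def F_def)
  moreover have "F f = opt_value"
    using opt_value_eq[OF u(1)] by (simp add: F_def)
  ultimately show ?thesis
    by blast
qed

section \<open>Attainment of the dual infimum\<close>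

lemma dual_attained: "\<exists>F. dual_functional k F \<and> (\<forall>F'. dual_functional k F' \<longrightarrow> F f \<le> F' f)"
proof -
  define V where "V = {F f |F. dual_functional k F}"
  have "V \<noteq> {}"
    using evaluation_dual_functional by (auto simp: V_def)
  obtain C where "\<And>F. dual_functional k F \<Longrightarrow> \<bar>F f\<bar> \<le> C"
    using dual_functional_bounded[OF data_in_polys_le(1)] by blast
  then have bdd: "bdd_below V"
    by (intro bdd_belowI[of _ "- C"]) (force simp: V_def abs_le_iff)
  have "\<exists>F. dual_functional k F \<and> F f < Inf V + 1 / real (Suc n)" for n
    using cInf_lessD[OF \<open>V \<noteq> {}\<close>, of "Inf V + 1 / real (Suc n)"] by (auto simp: V_def)
  then obtain F where F: "\<And>n. dual_functional k (F n)" "\<And>n. F n f < Inf V + 1 / real (Suc n)"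
    by metis
  have "F n f \<in> V" for n
    using F(1) by (auto simp: V_def)
  then have F_ge: "Inf V \<le> F n f" for n
    by (intro cInf_lower bdd)
  have "(\<lambda>n. F n f) \<longlonglongrightarrow> Inf V"
  proof (rule tendsto_sandwich[OF _ _ tendsto_const])
    show "(\<lambda>n. Inf V + 1 / real (Suc n)) \<longlonglongrightarrow> Inf V"
      using tendsto_add[OF tendsto_const LIMSEQ_Suc[OF lim_1_over_n], of "Inf V"] by simp
  qed (use F(2) F_ge in \<open>auto intro!: always_eventually less_imp_le\<close>)
  moreover obtain r G where r: "strict_mono r" and G: "\<forall>h\<in>polys_le D. (\<lambda>n. F (r n) h) \<longlonglongrightarrow> G h"
    "dual_functional k G"
    using dual_functional_compact[of "\<lambda>_. k" F] F(1) by auto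
  ultimately have "(\<lambda>n. F (r n) f) \<longlonglongrightarrow> Inf V"
    using LIMSEQ_subseq_LIMSEQ[of "\<lambda>n. F n f" "Inf V" r] by (simp add: comp_def)
  then have "G f = Inf V"
    using bspec[OF G(1) data_in_polys_le(1)] LIMSEQ_unique by blast
  then show ?thesis
    using G(2) bdd by (intro exI[of _ G]) (auto simp: V_def intro: cInf_lower)
qed

definition dual_value :: "nat \<Rightarrow> real" where
  "dual_value k = Inf {F f |F. dual_functional k F}"

lemma dual_value_attained:
  obtains F where "dual_functional k F" "F f = dual_value k"
proof -
  obtain F where "dual_functional k F" "\<And>F'. dual_functional k F' \<Longrightarrow> F f \<le> F' f"
    using dual_attained by blast
  moreover from this have "dual_value k = F f"
    unfolding dual_value_def by (intro cInf_eq_minimum) auto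
  ultimately show thesis
    using that by metis
qed

lemma dual_value_le:
  assumes "dual_functional k F"
  shows "dual_value k \<le> F f"
proof -
  obtain F' where "dual_functional k F'" "\<And>F. dual_functional k F \<Longrightarrow> F' f \<le> F f"
    using dual_attained by blast
  moreover from this have "dual_value k = F' f"
    unfolding dual_value_def by (intro cInf_eq_minimum) auto
  ultimately show ?thesis
    using assms by metis
qed

lemma r_dual_eq: "r_dual f g s \<phi> p Y \<nu> R gs k = ereal (dual_value k)"
proof -
  obtain F where F: "dual_functional k F" "F f = dual_value k"
    by (rule dual_value_attained)
  show ?thesis
    unfolding r_dual_def dual_feasible_eq
    using F dual_value_le data_in_polys_le(1)
    by (intro antisym INF_lower2[of "restrict F (polys_le D)"] INF_greatest) auto
qed

lemma dual_minimizer_iff: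
  "dual_minimizer f g s \<phi> p Y \<nu> R gs k L \<longleftrightarrow>
     (\<exists>F. dual_functional k F \<and> F f = dual_value k \<and> L = restrict F (polys_le D))"
  unfolding dual_minimizer_def dual_feasible_eq r_dual_eq using data_in_polys_le(1) by auto

lemma dual_value_le_opt_value: "dual_value k \<le> opt_value"
  using evaluation_dual_functional dual_value_le by metis

text \<open>The polynomials certified nonnegative by M and the multipliers. The signs are such that
  f - \<rho> g is a member exactly when \<rho> is primal feasible.\<close>

definition lagrangian_cone :: "nat \<Rightarrow> 'm mpoly set" where
  "lagrangian_cone k = {m - apply_y H p - (\<Sum>j\<in>{1..s}. \<eta> j *\<^sub>R \<phi> j) |m H \<eta>.
     m \<in> M \<and> linear H \<and> (\<forall>\<psi>\<in>P k. 0 \<le> H \<psi>) \<and> (\<forall>j\<in>{1..s}. 0 \<le> \<eta> j)}"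

lemma lagrangian_coneI:
  "m \<in> M \<Longrightarrow> linear H \<Longrightarrow> (\<And>\<psi>. \<psi> \<in> P k \<Longrightarrow> 0 \<le> H \<psi>) \<Longrightarrow> (\<And>j. j \<in> {1..s} \<Longrightarrow> 0 \<le> \<eta> j) \<Longrightarrow>
    m - apply_y H p - (\<Sum>j\<in>{1..s}. \<eta> j *\<^sub>R \<phi> j) \<in> lagrangian_cone k"
  unfolding lagrangian_cone_def by blast

lemma lagrangian_cone_add:
  assumes "h \<in> lagrangian_cone k" "h' \<in> lagrangian_cone k"
  shows "h + h' \<in> lagrangian_cone k"
proof -
  obtain m H \<eta> m' H' \<eta>' where
    h: "h = m - apply_y H p - (\<Sum>j\<in>{1..s}. \<eta> j *\<^sub>R \<phi> j)" "m \<in> M" "linear H"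
      "\<forall>\<psi>\<in>P k. 0 \<le> H \<psi>" "\<forall>j\<in>{1..s}. 0 \<le> \<eta> j" and
    h': "h' = m' - apply_y H' p - (\<Sum>j\<in>{1..s}. \<eta>' j *\<^sub>R \<phi> j)" "m' \<in> M" "linear H'"
      "\<forall>\<psi>\<in>P k. 0 \<le> H' \<psi>" "\<forall>j\<in>{1..s}. 0 \<le> \<eta>' j"
    using assms unfolding lagrangian_cone_def by blast
  have "(m + m') - apply_y (\<lambda>q. H q + H' q) p - (\<Sum>j\<in>{1..s}. (\<eta> j + \<eta>' j) *\<^sub>R \<phi> j) \<in> lagrangian_cone k"
    using h h' by (intro lagrangian_coneI M_cone_add linear_compose_add) auto
  then show ?thesis
    by (simp add: h(1) h'(1) apply_y_add scaleR_add_left sum.distrib algebra_simps)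
qed

lemma lagrangian_cone_scaleR:
  assumes "h \<in> lagrangian_cone k" "0 \<le> c"
  shows "c *\<^sub>R h \<in> lagrangian_cone k"
proof -
  obtain m H \<eta> where
    h: "h = m - apply_y H p - (\<Sum>j\<in>{1..s}. \<eta> j *\<^sub>R \<phi> j)" "m \<in> M" "linear H"
      "\<forall>\<psi>\<in>P k. 0 \<le> H \<psi>" "\<forall>j\<in>{1..s}. 0 \<le> \<eta> j"
    using assms unfolding lagrangian_cone_def by blast
  have "linear (\<lambda>q. c * H q)"
    using linear_compose_scale_right[OF h(3), of c] by simp
  then have "c *\<^sub>R m - apply_y (\<lambda>q. c * H q) p - (\<Sum>j\<in>{1..s}. (c * \<eta> j) *\<^sub>R \<phi> j) \<in> lagrangian_cone k"
    using h assms(2) by (intro lagrangian_coneI M_cone_scaleR) auto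
  then show ?thesis
    by (simp add: h(1) apply_y_scale scaleR_diff_right scaleR_sum_right)
qed

lemma apply_y_0: "apply_y (\<lambda>_. 0) p = 0"
  by (simp add: apply_y_eq lin_ext_def)

lemma M_subset_lagrangian_cone: "M \<subseteq> lagrangian_cone k"
  using lagrangian_coneI[of _ "\<lambda>_. 0" k "\<lambda>_. 0"] by (auto simp: apply_y_0 linear_zero_fun)

lemma minus_moment_in_lagrangian_cone:
  assumes "\<sigma> \<in> sos \<inter> polys_le (2 * k)"
  shows "- apply_y (moment \<nu> Y \<sigma>) p \<in> lagrangian_cone k"
  using lagrangian_coneI[OF zero_in_M linear_moment[OF borel fin supp compact, of \<sigma>], of k "\<lambda>_. 0"] assms
  by (auto simp: mem_P_cone)

lemma minus_constraint_in_lagrangian_cone: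
  assumes "i \<in> {1..s}"
  shows "- \<phi> i \<in> lagrangian_cone k"
proof -
  have "(\<Sum>j\<in>{1..s}. (if j = i then 1 else 0) *\<^sub>R \<phi> j) = \<phi> i"
    using assms by (simp add: if_distrib[of "\<lambda>c. c *\<^sub>R _"] cong: if_cong)
  then show ?thesis
    using lagrangian_coneI[OF zero_in_M linear_zero_fun, of k "\<lambda>j. if j = i then 1 else 0"]
    by (simp add: apply_y_0)
qed

lemma lagrangian_cone_subset: "lagrangian_cone k \<subseteq> polys_le D"
  using data_in_polys_le(3)
  by (auto simp: lagrangian_cone_def M_in_polys_le intro!: polys_le_closed apply_y_in_polys_le')

text \<open>From right to left it suffices to test three kinds of members: those of M, the
  \<open>- \<phi> i\<close>, and the negated images of p under moment functionals, which recover the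
  constraint on \<open>apply_x F p\<close>.\<close>

lemma dual_functional_iff:
  "dual_functional k F \<longleftrightarrow> linear F \<and> F g = 1 \<and> (\<forall>h\<in>lagrangian_cone k. 0 \<le> F h)"
proof
  assume F: "dual_functional k F"
  then have lin: "linear F" and P: "- apply_x F p \<in> P k"
    by (auto simp: dual_functional_def)
  have "0 \<le> F (m - apply_y H p - (\<Sum>j\<in>{1..s}. \<eta> j *\<^sub>R \<phi> j))"
    if "m \<in> M" "linear H" "\<forall>\<psi>\<in>P k. 0 \<le> H \<psi>" "\<forall>j\<in>{1..s}. 0 \<le> \<eta> j" for m H \<eta>
  proof -
    have "F (m - apply_y H p - (\<Sum>j\<in>{1..s}. \<eta> j *\<^sub>R \<phi> j)) = F m + H (- apply_x F p) - (\<Sum>j\<in>{1..s}. \<eta> j * F (\<phi> j))"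
      by (simp add: linear_diff[OF lin] linear_sum[OF lin] linear_scale[OF lin]
          linear_neg[OF that(2)] apply_x_apply_y[OF lin that(2)])
    moreover have "(\<Sum>j\<in>{1..s}. \<eta> j * F (\<phi> j)) \<le> 0"
      using F that(4) by (intro sum_nonpos mult_nonneg_nonpos) (auto simp: dual_functional_def)
    moreover have "0 \<le> F m" "0 \<le> H (- apply_x F p)"
      using F that P by (auto simp: dual_functional_def)
    ultimately show ?thesis
      by linarith
  qed
  then show "linear F \<and> F g = 1 \<and> (\<forall>h\<in>lagrangian_cone k. 0 \<le> F h)"
    using F by (auto simp: dual_functional_def lagrangian_cone_def)
next
  assume F: "linear F \<and> F g = 1 \<and> (\<forall>h\<in>lagrangian_cone k. 0 \<le> F h)"
  then have lin: "linear F"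
    by blast
  have "F h \<le> 0" if "- h \<in> lagrangian_cone k" for h
    using F that linear_neg[OF lin, of h] by force
  moreover have "\<forall>h\<in>M. 0 \<le> F h"
    using F M_subset_lagrangian_cone by blast
  ultimately show "dual_functional k F"
    using F minus_moment_in_lagrangian_cone minus_constraint_in_lagrangian_cone
    by (auto simp: dual_functional_def P_cone_eq)
qed

lemma r_primal_eq_Sup:
  "r_primal f g s \<phi> p Y \<nu> R gs k = Sup {ereal \<rho> |\<rho>. f - \<rho> *\<^sub>R g \<in> lagrangian_cone k}"
proof -
  have "(\<exists>H \<eta>. H \<in> dual_cone (polys_le (pdeg_y p)) (P k) \<and> (\<forall>j\<in>{1..s}. 0 \<le> (\<eta> :: nat \<Rightarrow> real) j) \<and>
     f - \<rho> *\<^sub>R g + apply_y H p + (\<Sum>j\<in>{1..s}. \<eta> j *\<^sub>R \<phi> j) \<in> M) \<longleftrightarrow> f - \<rho> *\<^sub>R g \<in> lagrangian_cone k" for \<rho>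
  proof
    assume "\<exists>H \<eta>. H \<in> dual_cone (polys_le (pdeg_y p)) (P k) \<and> (\<forall>j\<in>{1..s}. 0 \<le> (\<eta> :: nat \<Rightarrow> real) j) \<and>
     f - \<rho> *\<^sub>R g + apply_y H p + (\<Sum>j\<in>{1..s}. \<eta> j *\<^sub>R \<phi> j) \<in> M"
    then obtain H and \<eta> :: "nat \<Rightarrow> real" where
      H: "H \<in> dual_space (polys_le (pdeg_y p))" "\<forall>\<psi>\<in>P k. 0 \<le> H \<psi>" and \<eta>: "\<forall>j\<in>{1..s}. 0 \<le> \<eta> j"
      and m: "f - \<rho> *\<^sub>R g + apply_y H p + (\<Sum>j\<in>{1..s}. \<eta> j *\<^sub>R \<phi> j) \<in> M"
      by (auto simp: dual_cone_def)
    obtain H' where H': "linear H'" "\<And>h. h \<in> polys_le (pdeg_y p) \<Longrightarrow> H' h = H h"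
      using dual_space_linear_ext[OF H(1)] by blast
    have "apply_y H' p = apply_y H p"
      using H'(2) by (rule apply_y_cong[OF order_refl])
    moreover have "0 \<le> H' \<psi>" if "\<psi> \<in> P k" for \<psi>
      using that H H' by (auto simp: mem_P_cone)
    ultimately show "f - \<rho> *\<^sub>R g \<in> lagrangian_cone k"
      using lagrangian_coneI[OF m H'(1), of k \<eta>] \<eta> by simp
  next
    assume "f - \<rho> *\<^sub>R g \<in> lagrangian_cone k"
    then obtain m H \<eta> where
      m: "f - \<rho> *\<^sub>R g = m - apply_y H p - (\<Sum>j\<in>{1..s}. \<eta> j *\<^sub>R \<phi> j)" "m \<in> M" and
      H: "linear H" "\<forall>\<psi>\<in>P k. 0 \<le> H \<psi>" and \<eta>: "\<forall>j\<in>{1..s}. 0 \<le> \<eta> j"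
      unfolding lagrangian_cone_def by blast
    have "apply_y H p = apply_y (restrict H (polys_le (pdeg_y p))) p"
      by (rule apply_y_cong[OF order_refl]) simp
    moreover have "restrict H (polys_le (pdeg_y p)) \<in> dual_cone (polys_le (pdeg_y p)) (P k)"
      using H by (auto simp: dual_cone_def restrict_linear_in_dual_space mem_P_cone)
    ultimately show "\<exists>H \<eta>. H \<in> dual_cone (polys_le (pdeg_y p)) (P k) \<and> (\<forall>j\<in>{1..s}. 0 \<le> (\<eta> :: nat \<Rightarrow> real) j) \<and>
     f - \<rho> *\<^sub>R g + apply_y H p + (\<Sum>j\<in>{1..s}. \<eta> j *\<^sub>R \<phi> j) \<in> M"
      using m \<eta> by (intro exI[of _ "restrict H (polys_le (pdeg_y p))"] exI[of _ \<eta>]) simp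
  qed
  then show ?thesis
    unfolding r_primal_def by simp
qed

section \<open>Weak and strong duality\<close>

lemma lagrangian_cone_weak_duality:
  assumes "f - \<rho> *\<^sub>R g \<in> lagrangian_cone k"
  shows "\<rho> \<le> dual_value k"
proof -
  obtain F where F: "dual_functional k F" "F f = dual_value k"
    by (rule dual_value_attained)
  then have "0 \<le> F (f - \<rho> *\<^sub>R g)" "linear F" "F g = 1"
    using assms by (auto simp: dual_functional_iff)
  then show ?thesis
    using F(2) by (simp add: linear_diff linear_scale)
qed

text \<open>If f - \<rho> g were outside the cone, its negative could be adjoined without reaching
  -1. A functional nonnegative on the enlarged cone then gives, once rescaled, a dual feasible
  functional of value at most \<rho>.\<close>

lemma lagrangian_cone_strong_duality:
  assumes "\<rho> < dual_value k"
  shows "f - \<rho> *\<^sub>R g \<in> lagrangian_cone k"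
proof (rule ccontr)
  assume notin: "f - \<rho> *\<^sub>R g \<notin> lagrangian_cone k"
  define v where "v = f - \<rho> *\<^sub>R g"
  let ?B = "mon ` {a :: 'm \<Rightarrow>\<^sub>0 nat. mon_deg a \<le> D}"
  define N where "N = {h - t *\<^sub>R v |h t. h \<in> lagrangian_cone k \<and> 0 \<le> t}"
  have NI: "h - t *\<^sub>R v \<in> N" if "h \<in> lagrangian_cone k" "0 \<le> t" for h t
    using that unfolding N_def by blast
  have sub: "lagrangian_cone k \<subseteq> N"
    using NI[of _ 0] by auto
  have "1 \<in> ?B"
    using mon_0 by (force simp del: mon_0)
  then have span: "span (insert 1 ?B) = polys_le D"
    by (simp add: insert_absorb polys_le_eq_span)
  have "\<exists>F :: 'm mpoly \<Rightarrow> real. linear F \<and> F 1 = 1 \<and> (\<forall>v\<in>N \<inter> span (insert 1 ?B). 0 \<le> F v)"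
  proof (rule positive_functional_exists)
    fix h h' assume "h \<in> N" "h' \<in> N"
    then obtain a b t u where h: "h = a - t *\<^sub>R v" "h' = b - u *\<^sub>R v" and
      ab: "a \<in> lagrangian_cone k" "b \<in> lagrangian_cone k" "0 \<le> t" "0 \<le> u"
      unfolding N_def by blast
    have "h + h' = (a + b) - (t + u) *\<^sub>R v"
      by (simp add: h scaleR_add_left)
    also have "\<dots> \<in> N"
      using ab by (intro NI lagrangian_cone_add) auto
    finally show "h + h' \<in> N" .
  next
    fix c :: real and h assume "0 \<le> c" "h \<in> N"
    then obtain a t where "h = a - t *\<^sub>R v" "a \<in> lagrangian_cone k" "0 \<le> t"
      unfolding N_def by blast
    then show "c *\<^sub>R h \<in> N"
      using NI[of "c *\<^sub>R a" "c * t"] lagrangian_cone_scaleR \<open>0 \<le> c\<close> by (simp add: scaleR_diff_right)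
  next
    \<comment> \<open>If -1 = a - t v, then t v = a + 1 lies in the cone. For t > 0 so does v, and
      for t = 0 one gets a = -1, on which feasible functionals are negative.\<close>
    show "- 1 \<notin> N"
    proof
      assume "- 1 \<in> N"
      then obtain a t where a: "- 1 = a - t *\<^sub>R v" "a \<in> lagrangian_cone k" "0 \<le> t"
        unfolding N_def by blast
      then have "t *\<^sub>R v = a + 1"
        by (simp add: algebra_simps)
      moreover have a1: "a + 1 \<in> lagrangian_cone k"
        using a(2) one_in_M M_subset_lagrangian_cone by (auto intro: lagrangian_cone_add)
      ultimately have tv: "t *\<^sub>R v \<in> lagrangian_cone k"
        by simp
      show False
      proof (cases "t = 0")
        case True
        obtain F where F: "dual_functional k F"
          using evaluation_dual_functional by blast
        then have "0 \<le> F a" "linear F"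
          using a by (auto simp: dual_functional_iff)
        moreover have "a = - 1"
          using a(1) True by simp
        ultimately show False
          using dual_functional_one(1)[OF F] by (simp add: linear_neg)
      next
        case False
        then have "(1 / t) *\<^sub>R (t *\<^sub>R v) \<in> lagrangian_cone k"
          using a(3) by (intro lagrangian_cone_scaleR tv) auto
        then show False
          using False notin by (simp add: v_def)
      qed
    qed
  next
    show "finite ?B"
      by (intro finite_imageI finite_mon_deg_le)
  next
    fix h assume "h \<in> span (insert 1 ?B)"
    then obtain t where "of_real t + h \<in> M"
      using M_cone_order_unit unfolding span by blast
    then show "\<exists>t. t *\<^sub>R 1 + h \<in> N"
      using M_subset_lagrangian_cone sub by (auto simp: of_real_def)
  qed
  then obtain F :: "'m mpoly \<Rightarrow> real" where F: "linear F" "F 1 = 1" "\<And>h. h \<in> N \<Longrightarrow> h \<in> polys_le D \<Longrightarrow> 0 \<le> F h"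
    unfolding span by blast
  have pos: "0 \<le> F h" if "h \<in> lagrangian_cone k" for h
    using that sub lagrangian_cone_subset by (intro F(3)) auto
  \<comment> \<open>F is normalized at 1. The generator \<open>q2 g gs\<close> makes
    \<open>F g\<close> positive, so F can be renormalized at \<open>g\<close>.\<close>
  then have "gs * F 1 \<le> F g"
    using M_subset_lagrangian_cone by (intro functional_g_ge F(1)) auto
  then have g: "0 < F g"
    using F(2) gs_pos by simp
  have "0 - 1 *\<^sub>R v \<in> N"
    using zero_in_M M_subset_lagrangian_cone by (intro NI) auto
  then have "0 \<le> F (- v)"
    using data_in_polys_le by (intro F(3)) (auto simp: v_def)
  then have "F f \<le> \<rho> * F g"
    by (simp add: v_def linear_neg[OF F(1)] linear_diff[OF F(1)] linear_scale[OF F(1)])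
  then have "F f / F g \<le> \<rho>"
    using g by (simp add: field_simps)
  moreover have "dual_functional k (\<lambda>h. F h / F g)"
    using F(1) g pos by (auto simp: dual_functional_iff linear_add linear_scale add_divide_distrib intro!: linearI)
  ultimately show False
    using dual_value_le[of k "\<lambda>h. F h / F g"] assms by linarith
qed

lemma r_primal_eq: "r_primal f g s \<phi> p Y \<nu> R gs k = ereal (dual_value k)"
  unfolding r_primal_eq_Sup
proof (rule antisym)
  show "Sup {ereal \<rho> |\<rho>. f - \<rho> *\<^sub>R g \<in> lagrangian_cone k} \<le> ereal (dual_value k)"
    using lagrangian_cone_weak_duality by (intro Sup_least) auto
  show "ereal (dual_value k) \<le> Sup {ereal \<rho> |\<rho>. f - \<rho> *\<^sub>R g \<in> lagrangian_cone k}"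
  \<comment> \<open>Membership is available only strictly below the dual value; density of the order
    bridges the gap.\<close>
  proof (rule dense_le)
    fix x assume "x < ereal (dual_value k)"
    then obtain \<rho> where "x \<le> ereal \<rho>" "\<rho> < dual_value k"
      by (metis ereal_dense2 less_ereal.simps(1) less_imp_le)
    moreover from this have "ereal \<rho> \<le> Sup {ereal \<rho> |\<rho>. f - \<rho> *\<^sub>R g \<in> lagrangian_cone k}"
      using lagrangian_cone_strong_duality by (intro Sup_upper) auto
    ultimately show "x \<le> Sup {ereal \<rho> |\<rho>. f - \<rho> *\<^sub>R g \<in> lagrangian_cone k}"
      by (rule_tac order_trans)
  qed
qed

text \<open>Jensen's inequality applies to \<open>G\<close> divided by \<open>G 1\<close>. All
  levels k together are used to turn the integral conditions into pointwise ones on Y.\<close>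

lemma normalized_point_feasible:
  assumes G: "\<And>k. dual_functional k G"
  shows "normalized_point G \<in> feasible_set s \<phi> p Y"
    "peval f (normalized_point G) / peval g (normalized_point G) \<le> G f"
proof -
  let ?u = "normalized_point G"
  define F where "F h = G h / G 1" for h
  have lin: "linear G" and G_M: "\<forall>h\<in>M. 0 \<le> G h" and G_g: "G g = 1"
    using G by (auto simp: dual_functional_def)
  have G1: "0 < G 1"
    using dual_functional_one[OF G] by blast
  have linF: "linear F"
    unfolding F_def by (intro linearI) (simp_all add: linear_add[OF lin] linear_scale[OF lin] add_divide_distrib)
  have u: "?u = (\<chi> i. F (var i))"
    by (simp add: normalized_point_def F_def)
  have Jensen: "peval h ?u \<le> F h" if "sos_convex h" "h \<in> polys_le D" for h
    unfolding u
  proof (rule sos_convex_Jensen[OF linF _ _ that])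
    show "0 \<le> F \<sigma>" if "\<sigma> \<in> sos" "\<sigma> \<in> polys_le D" for \<sigma>
      using G_M sos_in_M_cone[OF that] G1 by (simp add: F_def)
  qed (use G1 in \<open>simp add: F_def\<close>)
  have "peval (\<phi> j) ?u \<le> 0" if "j \<in> {1..s}" for j
  proof -
    have "peval (\<phi> j) ?u \<le> F (\<phi> j)"
      using convex(1) data_in_polys_le(3) that by (intro Jensen) auto
    also have "\<dots> \<le> 0"
      using G[of 0] G1 that by (auto simp: F_def dual_functional_def divide_nonpos_pos)
    finally show ?thesis .
  qed
  moreover have "peval (sub_y p y) ?u \<le> 0" if "y \<in> Y" for y
  proof -
    have "peval (sub_y p y) ?u \<le> F (sub_y p y)"
      using convex(2) that polys_le_mono[OF sub_y_in_polys_le data_in_polys_le(5)] by (intro Jensen) auto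
    also have "\<dots> = peval (apply_x G p) y / G 1"
      by (simp add: F_def linear_sub_y[OF lin])
    also have "\<dots> \<le> 0"
    proof -
      have "0 \<le> peval (- apply_x G p) y"
        using G that by (intro P_cone_Inter_nonneg[OF borel fin supp compact]) (auto simp: dual_functional_def)
      then show ?thesis
        using G1 by (simp add: linear_neg[OF linear_peval] divide_nonpos_pos)
    qed
    finally show ?thesis .
  qed
  ultimately show K: "?u \<in> feasible_set s \<phi> p Y"
    by (simp add: feasible_set_def)
  have f_le: "peval f ?u \<le> G f / G 1"
    using Jensen[OF convex(3) data_in_polys_le(1)] by (simp add: F_def)
  \<comment> \<open>Jensen's inequality for \<open>- g\<close>, together with
    \<open>G g = 1\<close>.\<close>
  have g_ge: "1 / G 1 \<le> peval g ?u"
    using Jensen[OF convex(4) polys_le_closed(3)[OF data_in_polys_le(2)]]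
    by (simp add: F_def linear_neg[OF lin] G_g linear_neg[OF linear_peval])
  have f_le': "peval f ?u * G 1 \<le> G f"
    using f_le G1 by (simp add: field_simps)
  have g_pos: "0 < peval g ?u"
    using num_den K by blast
  show "peval f ?u / peval g ?u \<le> G f"
    using num_den
  proof
    assume "\<forall>x\<in>feasible_set s \<phi> p Y. peval f x \<ge> 0 \<and> peval g x > 0"
    then have "0 \<le> peval f ?u"
      using K by blast
    \<comment> \<open>With a nonnegative numerator the lower bound on the denominator is the useful
      direction.\<close>
    then have "peval f ?u / peval g ?u \<le> peval f ?u / (1 / G 1)"
      using g_ge G1 g_pos by (intro divide_left_mono) auto
    then show ?thesis
      using f_le' by simp
  next
    assume "pdeg g \<le> 1 \<and> (\<forall>x\<in>feasible_set s \<phi> p Y. peval g x > 0)"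
    then have "g \<in> polys_le (Suc 0)"
      by (simp add: polys_le_def)
    \<comment> \<open>An affine \<open>g\<close> has zero Hessian, so Jensen's inequality holds for
      \<open>g\<close> as well as \<open>- g\<close>. The resulting equality fixes the denominator,
      whatever the sign of the numerator.\<close>
    then have "partial i (partial j g) = 0" for i j
      by (intro partial_polys_le_0 partial_in_polys_le)
    then have "sos_convex g"
      by (auto simp: sos_convex_def intro!: exI[of _ "0::nat"])
    then have "peval g ?u \<le> 1 / G 1"
      using Jensen[of g] data_in_polys_le(2) by (simp add: F_def G_g)
    then have "peval g ?u = 1 / G 1"
      using g_ge by simp
    then show ?thesis
      using f_le' by simp
  qed
qed

section \<open>Limits of dual minimizers\<close>

lemma dual_functional_all_imp_optimal:
  assumes "\<And>k. dual_functional k G" "G f \<le> opt_value"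
  shows "normalized_point G \<in> optimal_set f g s \<phi> p Y" "G f = opt_value"
proof -
  note feas = normalized_point_feasible[OF assms(1)]
  show "normalized_point G \<in> optimal_set f g s \<phi> p Y"
    using feas assms(2) by (intro optimal_if_le) auto
  show "G f = opt_value"
    using opt_value_le[OF feas(1)] feas(2) assms(2) by linarith
qed

text \<open>An arbitrary starting subsequence makes the result serve three ends: existence of
  convergent subsequences, optimality of their limits, and convergence of the whole
  sequence.\<close>

lemma minimizers_accumulate_at_optimum:
  fixes \<kappa> :: "nat \<Rightarrow> nat"
  assumes \<kappa>: "strict_mono \<kappa>"
    and F: "\<And>k. dual_functional k (F k)" "\<And>k. F k f = dual_value k"
  shows "\<exists>r x. strict_mono r \<and> x \<in> optimal_set f g s \<phi> p Y \<and>
    (\<lambda>i. normalized_point (F (\<kappa> (r i)))) \<longlonglongrightarrow> x \<and> (\<lambda>i. dual_value (\<kappa> (r i))) \<longlonglongrightarrow> opt_value"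
proof -
  obtain r G where r: "strict_mono r"
    and lim: "\<And>h. h \<in> polys_le D \<Longrightarrow> (\<lambda>n. F (\<kappa> (r n)) h) \<longlonglongrightarrow> G h"
    and G: "\<And>k. \<forall>\<^sub>F n in sequentially. k \<le> \<kappa> n \<Longrightarrow> dual_functional k G"
    using dual_functional_compact[of \<kappa> "\<lambda>n. F (\<kappa> n)"] F(1) by blast
  have "\<forall>\<^sub>F n in sequentially. k \<le> \<kappa> n" for k
    using eventually_ge_at_top[of k] by eventually_elim (use seq_suble[OF \<kappa>] order_trans in blast)
  then have Gk: "dual_functional k G" for k
    by (rule G)
  have val: "(\<lambda>n. dual_value (\<kappa> (r n))) \<longlonglongrightarrow> G f"
    using lim[OF data_in_polys_le(1)] by (simp add: F(2))
  then have "G f \<le> opt_value"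
    by (rule tendsto_upperbound) (auto simp: dual_value_le_opt_value)
  note Gopt = dual_functional_all_imp_optimal[OF Gk this]
  have "(\<lambda>n. normalized_point (F (\<kappa> (r n)))) \<longlonglongrightarrow> normalized_point G"
    unfolding normalized_point_def
    using dual_functional_one(1)[OF Gk] data_in_polys_le(4)
    by (intro tendsto_vec_lambda tendsto_divide lim) auto
  then show ?thesis
    using r Gopt val by metis
qed

text \<open>The values increase with k and are bounded by the optimum, so the limit along one
  subsequence is the limit of all.\<close>

lemma dual_value_tendsto: "dual_value \<longlonglongrightarrow> opt_value"
proof -
  have "\<exists>F. dual_functional k F \<and> F f = dual_value k" for k
    by (rule dual_value_attained[of k]) blast
  then have "\<exists>F. \<forall>k. dual_functional k (F k) \<and> F k f = dual_value k"
    by metis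
  then obtain F where F: "\<And>k. dual_functional k (F k)" "\<And>k. F k f = dual_value k"
    by blast
  obtain r where r: "strict_mono r" "(\<lambda>i. dual_value (r i)) \<longlonglongrightarrow> opt_value"
    using minimizers_accumulate_at_optimum[OF strict_mono_id F] by auto
  have inc: "incseq dual_value"
    using F dual_functional_antimono dual_value_le by (metis incseq_def)
  then obtain l where l: "dual_value \<longlonglongrightarrow> l"
    using incseq_convergent[of dual_value opt_value] dual_value_le_opt_value by blast
  then have "l = opt_value"
    using LIMSEQ_subseq_LIMSEQ[OF l r(1)] r(2) LIMSEQ_unique by (auto simp: comp_def)
  then show ?thesis
    using l by simp
qed

text \<open>Division by zero yields 0 in HOL, so the first claim is what gives the normalized points
  their meaning.\<close>

lemma minimizer_points:
  fixes \<kappa> :: "nat \<Rightarrow> nat"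
  assumes L: "\<And>k. dual_minimizer f g s \<phi> p Y \<nu> R gs k (L k)"
  shows "L k 1 \<noteq> 0"
    "strict_mono \<kappa> \<Longrightarrow> \<exists>r x. strict_mono r \<and> x \<in> optimal_set f g s \<phi> p Y \<and>
      (\<lambda>i. normalized_point (L (\<kappa> (r i)))) \<longlonglongrightarrow> x"
proof -
  obtain F where F: "\<And>k. dual_functional k (F k)" "\<And>k. F k f = dual_value k"
    "\<And>k. L k = restrict (F k) (polys_le D)"
    using L unfolding dual_minimizer_iff by metis
  show "L k 1 \<noteq> 0"
    using dual_functional_one(1)[OF F(1), of k] by (simp add: F(3))
  have "normalized_point (L k) = normalized_point (F k)" for k
    using data_in_polys_le(4) by (simp add: normalized_point_def F(3))
  then show "\<exists>r x. strict_mono r \<and> x \<in> optimal_set f g s \<phi> p Y \<and>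
      (\<lambda>i. normalized_point (L (\<kappa> (r i)))) \<longlonglongrightarrow> x" if "strict_mono \<kappa>"
    using minimizers_accumulate_at_optimum[OF that F(1,2)] by auto
qed

end

text \<open>Otherwise infinitely many terms stay at distance e from u, and enumerating them gives a
  subsequence with no further subsequence tending to u.\<close>

lemma tendsto_if_subseq_tendsto:
  fixes X :: "nat \<Rightarrow> 'a::metric_space"
  assumes "\<And>\<kappa> :: nat \<Rightarrow> nat. strict_mono \<kappa> \<Longrightarrow> \<exists>r :: nat \<Rightarrow> nat. strict_mono r \<and> (\<lambda>i. X (\<kappa> (r i))) \<longlonglongrightarrow> u"
  shows "X \<longlonglongrightarrow> u"
proof (rule ccontr)
  assume "\<not> X \<longlonglongrightarrow> u"
  then obtain e where "0 < e" and e: "\<And>N. \<exists>n\<ge>N. e \<le> dist (X n) u"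
    unfolding lim_sequentially by (meson not_less)
  then have "infinite {n. e \<le> dist (X n) u}"
    unfolding infinite_nat_iff_unbounded_le by auto
  then obtain \<kappa> :: "nat \<Rightarrow> nat" where \<kappa>: "strict_mono \<kappa>" "\<And>n. e \<le> dist (X (\<kappa> n)) u"
    using infinite_enumerate by blast
  then obtain r where "(\<lambda>i. X (\<kappa> (r i))) \<longlonglongrightarrow> u"
    using assms[OF \<kappa>(1)] by blast
  then obtain N where "dist (X (\<kappa> (r N))) u < e"
    using \<open>0 < e\<close> unfolding lim_sequentially by blast
  then show False
    using \<kappa>(2)[of "r N"] by linarith
qed

theorem theorem3p1:
  fixes f g :: "'m::finite mpoly"
    and s :: nat
    and \<phi> :: "nat \<Rightarrow> 'm mpoly"
    and p :: "('m, 'n::finite) mpoly2"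
    and Y :: "(real^'n) set"
    and \<nu> :: "(real^'n) measure"
    and R gs :: real
  defines "K \<equiv> feasible_set s \<phi> p Y"
    and "S \<equiv> optimal_set f g s \<phi> p Y"
  assumes S_nonempty: "S \<noteq> {}"
    and d_pos: "half_deg f g s \<phi> p \<ge> 1"
    and nu_borel: "sets \<nu> = sets borel"
    and nu_finite: "finite_measure \<nu>"
    and nu_support: "measure_support \<nu> = Y"
    and R_pos: "R > 0"
    and gs_pos: "gs > 0"
    and R_gs: "\<exists>u\<in>S. norm u \<le> R \<and> peval g u \<ge> gs"
    and A1_i: "\<forall>y\<in>Y. \<forall>i. -1 \<le> y $ i \<and> y $ i \<le> 1" "closed Y"
    and A1_ii: "\<forall>j\<in>{1..s}. sos_convex (\<phi> j)" "\<forall>y\<in>Y. sos_convex (sub_y p y)"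
    and A2_i: "sos_convex f" "sos_convex (- g)"
    and A2_ii: "(\<forall>x\<in>K. peval f x \<ge> 0 \<and> peval g x > 0) \<or> (pdeg g \<le> 1 \<and> (\<forall>x\<in>K. peval g x > 0))"
    and A3: "\<exists>u\<in>K. (\<forall>y\<in>Y. peval (sub_y p y) u < 0) \<and> (\<forall>j\<in>{1..s}. peval (\<phi> j) u < 0)"
  shows
    "(\<forall>k. r_primal f g s \<phi> p Y \<nu> R gs k = r_dual f g s \<phi> p Y \<nu> R gs k \<and>
          r_dual f g s \<phi> p Y \<nu> R gs k \<le> r_star f g s \<phi> p Y \<and>
          (\<exists>L. dual_minimizer f g s \<phi> p Y \<nu> R gs k L)) \<and>
     (\<lambda>k. r_primal f g s \<phi> p Y \<nu> R gs k) \<longlonglongrightarrow> r_star f g s \<phi> p Y \<and>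
     (\<lambda>k. r_dual f g s \<phi> p Y \<nu> R gs k) \<longlonglongrightarrow> r_star f g s \<phi> p Y \<and>
     (\<forall>L. (\<forall>k. dual_minimizer f g s \<phi> p Y \<nu> R gs k (L k)) \<longrightarrow>
        (\<forall>k. L k 1 \<noteq> 0) \<and>
        (\<exists>\<kappa> x. strict_mono \<kappa> \<and> (\<lambda>i. normalized_point (L (\<kappa> i))) \<longlonglongrightarrow> x) \<and>
        (\<forall>\<kappa> x. strict_mono \<kappa> \<and> (\<lambda>i. normalized_point (L (\<kappa> i))) \<longlonglongrightarrow> x \<longrightarrow> x \<in> S) \<and>
        (\<forall>u. S = {u} \<longrightarrow> (\<lambda>k. normalized_point (L k)) \<longlonglongrightarrow> u))"
proof -
  have "bounded Y"
  proof (rule bounded_subset[OF bounded_cbox])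
    show "Y \<subseteq> cbox (\<chi> i. - 1) (\<chi> i. 1)"
      using A1_i(1) by (auto simp: mem_box_cart)
  qed
  then have "compact Y"
    using A1_i(2) by (simp add: compact_eq_bounded_closed)
  note setting = d_pos nu_borel nu_finite nu_support this gs_pos R_gs[unfolded S_def] A1_ii A2_i A2_ii[unfolded K_def]
  note vals = r_primal_eq[OF setting] r_dual_eq[OF setting] r_star_eq[OF setting]
  have "r_dual f g s \<phi> p Y \<nu> R gs k \<le> r_star f g s \<phi> p Y" for k
    unfolding vals by (simp add: dual_value_le_opt_value[OF setting])
  moreover have "\<exists>L. dual_minimizer f g s \<phi> p Y \<nu> R gs k L" for k
    using dual_value_attained[OF setting] by (auto simp: dual_minimizer_iff[OF setting])
  moreover have "(\<lambda>k. r_dual f g s \<phi> p Y \<nu> R gs k) \<longlonglongrightarrow> r_star f g s \<phi> p Y"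
    unfolding vals using dual_value_tendsto[OF setting] by simp
  moreover have "(\<forall>k. L k 1 \<noteq> 0) \<and>
        (\<exists>\<kappa> x. strict_mono \<kappa> \<and> (\<lambda>i. normalized_point (L (\<kappa> i))) \<longlonglongrightarrow> x) \<and>
        (\<forall>\<kappa> x. strict_mono \<kappa> \<and> (\<lambda>i. normalized_point (L (\<kappa> i))) \<longlonglongrightarrow> x \<longrightarrow> x \<in> S) \<and>
        (\<forall>u. S = {u} \<longrightarrow> (\<lambda>k. normalized_point (L k)) \<longlonglongrightarrow> u)"
    if "\<forall>k. dual_minimizer f g s \<phi> p Y \<nu> R gs k (L k)" for L
  proof -
    note points = minimizer_points[OF setting that[rule_format], folded S_def]
    have "\<exists>\<kappa> x. strict_mono \<kappa> \<and> (\<lambda>i. normalized_point (L (\<kappa> i))) \<longlonglongrightarrow> x"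
      using points(2)[OF strict_mono_id] by auto
    moreover have "x \<in> S" if \<kappa>: "strict_mono \<kappa>" "(\<lambda>i. normalized_point (L (\<kappa> i))) \<longlonglongrightarrow> x" for \<kappa> x
    proof -
      \<comment> \<open>A further subsequence has its limit in S, and that limit must be x.\<close>
      obtain r z where r: "strict_mono r" "z \<in> S" "(\<lambda>i. normalized_point (L (\<kappa> (r i)))) \<longlonglongrightarrow> z"
        using points(2)[OF \<kappa>(1)] by blast
      then have "x = z"
        using LIMSEQ_subseq_LIMSEQ[OF \<kappa>(2) r(1)] LIMSEQ_unique by (auto simp: comp_def)
      then show ?thesis
        using r(2) by simp
    qed
    moreover have "(\<lambda>k. normalized_point (L k)) \<longlonglongrightarrow> u" if "S = {u}" for u
      by (rule tendsto_if_subseq_tendsto) (use points(2) that in blast)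
    ultimately show ?thesis
      using points(1) by blast
  qed
  ultimately show ?thesis
    unfolding vals(1) vals(2) by blast
qed

end
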